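(* Suppose that the process $(\mathcal H,V,\mathfrak h)$, with multiplicity space $\mathcal P$, is unital. For linear operators $X:\mathcal H\to\mathcal H$ and $Y:\mathcal P\to\mathcal P$ and for $n\in\mathbb N_0$, $m\in\mathbb N$ define the following linear operators on $\mathcal H$ (called observables): $$X_n:=V^{(n)}\Big(X\otimes\bigotimes_1^n1_{\mathcal P}\Big)V^{(n)*},\qquad Y_m:=V^{(m)}\Big(1_{\mathcal H}\otimes\bigotimes_1^{m-1}1_{\mathcal P}\otimes Y\Big)V^{(m)*}$$ (empty tensor products are omitted for $n=0$ and $m=1$). Then the observables $Y_m$ commute with each other, and $Y_m$ commutes with $X_n$ whenever $m\le n$. Now suppose further that $Y\epsilon_j=j\,\epsilon_j$ for the orthonormal basis $(\epsilon_j)_{j=1}^d$ of $\mathcal P$ which is used to define the isometries $V_j$. If the process is prepared in a vector state given by a unit vector $\eta$ in the range of $V_\alpha$, where the $m$-th letter in $\alpha$ is equal to $k$, then the measurement of $Y_m$ yields the outcome $k$ with certainty.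
   Context: Let $\mathcal P$ be a separable Hilbert space with orthonormal basis $(\epsilon_k)_{k=1}^d$ ($d\in\mathbb N$ or $d=\infty$), and let $F_d^+$ be the free semigroup of words in the letters $1,\dots,d$, including the empty word $0$. A row isometry on a separable Hilbert space $\mathcal H$ is an isometry $V:\mathcal H\otimes\mathcal P\to\mathcal H$; put $V_k\xi=V(\xi\otimes\epsilon_k)$, so that also $V=(V_1,\dots,V_d):\bigoplus_1^d\mathcal H\to\mathcal H$, and $V_\alpha=V_{\alpha_1}\cdots V_{\alpha_n}$ for $\alpha=\alpha_1\dots\alpha_n$, $V_0=1$. $V$ is a row unitary if $\sum_kV_kV_k^*=1$. A closed subspace $\mathfrak h$ is co-invariant if $V_k^*\mathfrak h\subset\mathfrak h$ for all $k$. A process (short for minimal discrete weak Markov process) is a triple $(\mathcal H,V,\mathfrak h)$ where $V$ is a row isometry on $\mathcal H$, $\mathfrak h\subset\mathcal H$ is a co-invariant closed subspace, and $\mathcal H=\overline{\mathrm{span}}\{V_\alpha\mathfrak h:\alpha\in F_d^+\}$. It is unital if $V$ is a row unitary. The row isometries $V^{(n)}:\mathcal H\otimes\bigotimes_1^n\mathcal P\to\mathcal H$, $n\in\mathbb N$, are defined inductively by $V^{(1)}:=V$ and, for $\tilde\xi\in\mathcal H\otimes\bigotimes_1^{n-1}\mathcal P$ and $\eta\in\mathcal P$, $$V^{(n)}(\tilde\xi\otimes\eta)=V\big(V^{(n-1)}\tilde\xi\otimes\eta\big).$$ For $n=0$, $V^{(0)}=1_{\mathcal H}$, so $X_0=X$.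 By the standard rules of quantum mechanics, for $Y\epsilon_j=j\epsilon_j$ the probability that a measurement of $Y_m$ in the vector state given by the unit vector $\eta$ yields the result $k$ is $$\Big\langle\eta,\;V^{(m)}\Big(1_{\mathcal H}\otimes\bigotimes_1^{m-1}1_{\mathcal P}\otimes P_{\epsilon_k}\Big)V^{(m)*}\eta\Big\rangle,$$ where $P_{\epsilon_k}$ is the orthogonal projection of $\mathcal P$ onto $\mathbb C\epsilon_k$; "with certainty" means that this probability is $1$.
   Formalization: In V^(n)(ξ̃⊗η)=V(V^(n-1)ξ̃⊗η) the new factor η is taken as the first copy of P, older copies shifted by one; with η last, Y_m=Y_1 for all m and the outcome claim fails. X and Y in the commutation claims are bounded. *)

theory Defs
  imports "HOL-Analysis.Analysis" "HOL-Library.Extended_Nat"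
begin

section \<open>Complex Hilbert spaces\<close>

text \<open>
  A complex inner product space is a real one with a compatible complex scalar multiplication
  and a complex inner product whose real part is the given real inner product, so norm,
  topology and completeness are those of the real library. The complex inner product is
  linear in its second argument.
\<close>

class complex_inner = real_inner +
  fixes scaleC :: "complex \<Rightarrow> 'a \<Rightarrow> 'a" (infixr "*\<^sub>C" 75)
    and cinner :: "'a \<Rightarrow> 'a \<Rightarrow> complex"
  assumes scaleC_add_right: "c *\<^sub>C (x + y) = c *\<^sub>C x + c *\<^sub>C y"
    and scaleC_add_left: "(c + c') *\<^sub>C x = c *\<^sub>C x + c' *\<^sub>C x"
    and scaleC_scaleC: "c *\<^sub>C c' *\<^sub>C x = (c * c') *\<^sub>C x"
    and scaleR_scaleC: "r *\<^sub>R x = complex_of_real r *\<^sub>C x"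
    and cinner_add_right: "cinner x (y + z) = cinner x y + cinner x z"
    and cinner_scaleC_right: "cinner x (c *\<^sub>C y) = c * cinner x y"
    and cinner_commute: "cinner x y = cnj (cinner y x)"
    and inner_eq_Re_cinner: "inner x y = Re (cinner x y)"

class chilbert_space = complex_inner + complete_space

instantiation complex :: chilbert_space
begin

definition scaleC_complex :: "complex \<Rightarrow> complex \<Rightarrow> complex"
  where "scaleC_complex = (*)"

definition cinner_complex :: "complex \<Rightarrow> complex \<Rightarrow> complex"
  where "cinner_complex x y = cnj x * y"

instance
  by standard
    (auto simp: scaleC_complex_def cinner_complex_def inner_complex_def algebra_simps
       complex_eq_iff)

end

global_interpretation complex_vector:
  vector_space "scaleC :: complex \<Rightarrow> 'a \<Rightarrow> 'a::complex_inner"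
  defines csubspace = complex_vector.subspace
    and cspan = complex_vector.span
proof
  fix x :: 'a
  show "1 *\<^sub>C x = x"
    using scaleR_scaleC[of 1 x] by simp
qed (simp_all add: scaleC_add_right scaleC_add_left scaleC_scaleC)

definition separable_set :: "'a::topological_space set \<Rightarrow> bool" where
  "separable_set S \<longleftrightarrow> (\<exists>C. countable C \<and> C \<subseteq> S \<and> S \<subseteq> closure C)"

definition clinear_on :: "'a::complex_inner set \<Rightarrow> ('a \<Rightarrow> 'b::complex_inner) \<Rightarrow> bool" where
  "clinear_on S f \<longleftrightarrow>
     (\<forall>x\<in>S. \<forall>y\<in>S. f (x + y) = f x + f y) \<and> (\<forall>c. \<forall>x\<in>S. f (c *\<^sub>C x) = c *\<^sub>C f x)"

definition bounded_clinear_on :: "'a::complex_inner set \<Rightarrow> ('a \<Rightarrow> 'b::complex_inner) \<Rightarrow> bool"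
  where
  "bounded_clinear_on S f \<longleftrightarrow> clinear_on S f \<and> (\<exists>K. \<forall>x\<in>S. norm (f x) \<le> K * norm x)"

definition isometry_on :: "'a::complex_inner set \<Rightarrow> ('a \<Rightarrow> 'b::complex_inner) \<Rightarrow> bool" where
  "isometry_on S f \<longleftrightarrow> clinear_on S f \<and> (\<forall>x\<in>S. norm (f x) = norm x)"

text \<open>The adjoint of a bounded operator that is defined on the closed subspace \<open>S\<close>.\<close>

definition adjoint_on :: "'a::complex_inner set \<Rightarrow> ('a \<Rightarrow> 'b::complex_inner) \<Rightarrow> 'b \<Rightarrow> 'a" where
  "adjoint_on S f y = (THE z. z \<in> S \<and> (\<forall>x\<in>S. cinner x z = cinner (f x) y))"

definition projection_onto :: "'a::complex_inner set \<Rightarrow> 'a \<Rightarrow> 'a" where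
  "projection_onto M x = (THE y. y \<in> M \<and> (\<forall>z\<in>M. cinner z (x - y) = 0))"

definition orthonormal_basis_on :: "'i set \<Rightarrow> ('i \<Rightarrow> 'a::complex_inner) \<Rightarrow> bool" where
  "orthonormal_basis_on J \<epsilon> \<longleftrightarrow>
     (\<forall>i\<in>J. \<forall>j\<in>J. cinner (\<epsilon> i) (\<epsilon> j) = (if i = j then 1 else 0)) \<and>
     closure (cspan (\<epsilon> ` J)) = UNIV"


section \<open>The Hilbert space tensor products of \<open>\<H>\<close> with powers of \<open>\<P>\<close>\<close>

text \<open>
  A type cannot depend on the number of factors, so the spaces
  \<open>\<H> \<otimes> \<P> \<otimes> \<dots> \<otimes> \<P>\<close> are closed subspaces of one Hilbert space \<open>'t\<close>. They are characterised
  up to unitary equivalence: \<open>tens \<xi> [\<eta>\<^sub>1, \<dots>, \<eta>\<^sub>n]\<close> is the elementary tensor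
  \<open>\<xi> \<otimes> \<eta>\<^sub>1 \<otimes> \<dots> \<otimes> \<eta>\<^sub>n\<close>, it is multilinear, inner products of elementary tensors multiply, and
  the elementary tensors with \<open>n\<close> factors from \<open>\<P>\<close> are total in the tensor product. How the
  subspaces for different \<open>n\<close> lie in \<open>'t\<close> relative to each other is irrelevant (in a model they
  may for instance be the summands of a Fock space). For \<open>n = 0\<close> the map \<open>\<xi> \<mapsto> tens \<xi> []\<close>
  identifies \<open>\<H>\<close> with the tensor product in which the \<open>\<P>\<close> factors are omitted.
\<close>

definition hilbert_tensor ::
  "('h::complex_inner \<Rightarrow> 'p::complex_inner list \<Rightarrow> 't::complex_inner) \<Rightarrow> bool" where
  "hilbert_tensor tens \<longleftrightarrow>
     (\<forall>\<eta>s. clinear_on UNIV (\<lambda>\<xi>. tens \<xi> \<eta>s)) \<and>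
     (\<forall>\<xi> \<eta>s \<zeta>s. clinear_on UNIV (\<lambda>\<eta>. tens \<xi> (\<eta>s @ \<eta> # \<zeta>s))) \<and>
     (\<forall>\<xi> \<xi>' \<eta>s \<eta>s'. length \<eta>s = length \<eta>s' \<longrightarrow>
        cinner (tens \<xi> \<eta>s) (tens \<xi>' \<eta>s') = cinner \<xi> \<xi>' * prod_list (map2 cinner \<eta>s \<eta>s'))"

definition tensor_space ::
  "('h::complex_inner \<Rightarrow> 'p::complex_inner list \<Rightarrow> 't::complex_inner) \<Rightarrow> nat \<Rightarrow> 't set" where
  "tensor_space tens n = closure (cspan {tens \<xi> \<eta>s |\<xi> \<eta>s. length \<eta>s = n})"

text \<open>
  The bounded operator on \<open>tensor_space tens n\<close> with prescribed values on elementary tensors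
  (set to zero outside of that subspace, so that it is unique).
\<close>

definition tensor_extend ::
  "('h::complex_inner \<Rightarrow> 'p::complex_inner list \<Rightarrow> 't::complex_inner) \<Rightarrow> nat \<Rightarrow>
   ('h \<Rightarrow> 'p list \<Rightarrow> 'b::complex_inner) \<Rightarrow> 't \<Rightarrow> 'b" where
  "tensor_extend tens n f =
     (THE A. bounded_clinear_on (tensor_space tens n) A \<and>
             (\<forall>\<xi> \<eta>s. length \<eta>s = n \<longrightarrow> A (tens \<xi> \<eta>s) = f \<xi> \<eta>s) \<and>
             (\<forall>x. x \<notin> tensor_space tens n \<longrightarrow> A x = 0))"

text \<open>\<open>tensor_op tens X [Y\<^sub>1, \<dots>, Y\<^sub>n]\<close> is \<open>X \<otimes> Y\<^sub>1 \<otimes> \<dots> \<otimes> Y\<^sub>n\<close>.\<close>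

definition tensor_op ::
  "('h::complex_inner \<Rightarrow> 'p::complex_inner list \<Rightarrow> 't::complex_inner) \<Rightarrow>
   ('h \<Rightarrow> 'h) \<Rightarrow> ('p \<Rightarrow> 'p) list \<Rightarrow> 't \<Rightarrow> 't" where
  "tensor_op tens X Ys =
     tensor_extend tens (length Ys) (\<lambda>\<xi> \<eta>s. tens (X \<xi>) (map2 (\<lambda>Y \<eta>. Y \<eta>) Ys \<eta>s))"


section \<open>Processes\<close>

definition letters :: "enat \<Rightarrow> nat set" where
  "letters d = {k. 1 \<le> k \<and> enat k \<le> d}"

definition row_isometry ::
  "('h::complex_inner \<Rightarrow> 'p::complex_inner list \<Rightarrow> 't::complex_inner) \<Rightarrow> ('t \<Rightarrow> 'h) \<Rightarrow> bool"
  where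
  "row_isometry tens V \<longleftrightarrow> isometry_on (tensor_space tens 1) V"

definition row_entry ::
  "('h::complex_inner \<Rightarrow> 'p::complex_inner list \<Rightarrow> 't::complex_inner) \<Rightarrow>
   (nat \<Rightarrow> 'p) \<Rightarrow> ('t \<Rightarrow> 'h) \<Rightarrow> nat \<Rightarrow> 'h \<Rightarrow> 'h" where
  "row_entry tens \<epsilon> V k \<xi> = V (tens \<xi> [\<epsilon> k])"

fun row_word ::
  "('h::complex_inner \<Rightarrow> 'p::complex_inner list \<Rightarrow> 't::complex_inner) \<Rightarrow>
   (nat \<Rightarrow> 'p) \<Rightarrow> ('t \<Rightarrow> 'h) \<Rightarrow> nat list \<Rightarrow> 'h \<Rightarrow> 'h" where
  "row_word tens \<epsilon> V [] = id"
| "row_word tens \<epsilon> V (k # \<alpha>) = row_entry tens \<epsilon> V k \<circ> row_word tens \<epsilon> V \<alpha>"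

text \<open>For infinite \<open>d\<close> the sum of the \<open>V\<^sub>k V\<^sub>k\<^sup>*\<close> converges in the strong operator topology.\<close>

definition row_unitary ::
  "('h::complex_inner \<Rightarrow> 'p::complex_inner list \<Rightarrow> 't::complex_inner) \<Rightarrow> enat \<Rightarrow>
   (nat \<Rightarrow> 'p) \<Rightarrow> ('t \<Rightarrow> 'h) \<Rightarrow> bool" where
  "row_unitary tens d \<epsilon> V \<longleftrightarrow> row_isometry tens V \<and>
     (\<forall>\<xi>. ((\<lambda>k. row_entry tens \<epsilon> V k (adjoint_on UNIV (row_entry tens \<epsilon> V k) \<xi>)) has_sum \<xi>)
            (letters d))"

definition markov_process ::
  "('h::complex_inner \<Rightarrow> 'p::complex_inner list \<Rightarrow> 't::complex_inner) \<Rightarrow> enat \<Rightarrow>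
   (nat \<Rightarrow> 'p) \<Rightarrow> ('t \<Rightarrow> 'h) \<Rightarrow> 'h set \<Rightarrow> bool" where
  "markov_process tens d \<epsilon> V \<hh> \<longleftrightarrow>
     row_isometry tens V \<and>
     csubspace \<hh> \<and> closed \<hh> \<and>
     (\<forall>k\<in>letters d. adjoint_on UNIV (row_entry tens \<epsilon> V k) ` \<hh> \<subseteq> \<hh>) \<and>
     closure (cspan (\<Union>\<alpha>\<in>{\<alpha>. set \<alpha> \<subseteq> letters d}. row_word tens \<epsilon> V \<alpha> ` \<hh>)) = UNIV"

definition unital_process ::
  "('h::complex_inner \<Rightarrow> 'p::complex_inner list \<Rightarrow> 't::complex_inner) \<Rightarrow> enat \<Rightarrow>
   (nat \<Rightarrow> 'p) \<Rightarrow> ('t \<Rightarrow> 'h) \<Rightarrow> 'h set \<Rightarrow> bool" where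
  "unital_process tens d \<epsilon> V \<hh> \<longleftrightarrow> markov_process tens d \<epsilon> V \<hh> \<and> row_unitary tens d \<epsilon> V"

text \<open>
  The row isometries \<open>V\<^sup>(\<^sup>n\<^sup>)\<close> satisfy \<open>V\<^sup>(\<^sup>n\<^sup>)(\<xi> \<otimes> \<eta>) = V(V\<^sup>(\<^sup>n\<^sup>-\<^sup>1\<^sup>) \<xi> \<otimes> \<eta>)\<close> for \<open>\<xi>\<close> in the tensor product
  with \<open>n - 1\<close> copies of \<open>\<P>\<close>; it suffices to demand this for elementary tensors \<open>\<xi>\<close>.

  The identification of this domain with the tensor product with the copies \<open>1, \<dots>, n\<close> of \<open>\<P>\<close>
  matters. Here the new factor \<open>\<eta>\<close> is the first copy, and the old copies \<open>1, \<dots>, n - 1\<close> become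
  the copies \<open>2, \<dots>, n\<close>. Thus \<open>V\<^sup>(\<^sup>n\<^sup>)(\<xi> \<otimes> \<epsilon>\<^bsub>\<alpha>\<^sub>1\<^esub> \<otimes> \<dots> \<otimes> \<epsilon>\<^bsub>\<alpha>\<^sub>n\<^esub>) = V\<^sub>\<alpha> \<xi>\<close>, and the \<open>m\<close>-th copy of \<open>\<P>\<close>
  belongs to the \<open>m\<close>-th letter of \<open>\<alpha>\<close>. If \<open>\<eta>\<close> were made the last copy, then
  \<open>V\<^sup>(\<^sup>m\<^sup>)(1 \<otimes> Y)V\<^sup>(\<^sup>m\<^sup>)\<^sup>* = V(V\<^sup>(\<^sup>m\<^sup>-\<^sup>1\<^sup>)V\<^sup>(\<^sup>m\<^sup>-\<^sup>1\<^sup>)\<^sup>* \<otimes> Y)V\<^sup>*\<close> would equal \<open>V(1 \<otimes> Y)V\<^sup>*\<close> for every \<open>m\<close>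
  (for a row unitary \<open>V\<close>), so each \<open>Y\<^sub>m\<close> would measure the first letter of \<open>\<alpha>\<close>.
\<close>

fun row_power ::
  "('h::complex_inner \<Rightarrow> 'p::complex_inner list \<Rightarrow> 't::complex_inner) \<Rightarrow> ('t \<Rightarrow> 'h) \<Rightarrow>
   nat \<Rightarrow> 't \<Rightarrow> 'h" where
  "row_power tens V 0 = tensor_extend tens 0 (\<lambda>\<xi> _. \<xi>)"
| "row_power tens V (Suc 0) = V"
| "row_power tens V (Suc (Suc n)) =
     tensor_extend tens (Suc (Suc n))
       (\<lambda>\<xi> \<eta>s. V (tens (row_power tens V (Suc n) (tens \<xi> (tl \<eta>s))) [hd \<eta>s]))"

text \<open>\<open>V\<^sup>(\<^sup>n\<^sup>)(X \<otimes> Y\<^sub>1 \<otimes> \<dots> \<otimes> Y\<^sub>n)V\<^sup>(\<^sup>n\<^sup>)\<^sup>*\<close>\<close>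

definition row_conj ::
  "('h::complex_inner \<Rightarrow> 'p::complex_inner list \<Rightarrow> 't::complex_inner) \<Rightarrow> ('t \<Rightarrow> 'h) \<Rightarrow>
   ('h \<Rightarrow> 'h) \<Rightarrow> ('p \<Rightarrow> 'p) list \<Rightarrow> 'h \<Rightarrow> 'h" where
  "row_conj tens V X Ys =
     row_power tens V (length Ys) \<circ> tensor_op tens X Ys \<circ>
     adjoint_on (tensor_space tens (length Ys)) (row_power tens V (length Ys))"

definition state_observable ::
  "('h::complex_inner \<Rightarrow> 'p::complex_inner list \<Rightarrow> 't::complex_inner) \<Rightarrow> ('t \<Rightarrow> 'h) \<Rightarrow>
   ('h \<Rightarrow> 'h) \<Rightarrow> nat \<Rightarrow> 'h \<Rightarrow> 'h" where
  "state_observable tens V X n = row_conj tens V X (replicate n id)"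

text \<open>The observable \<open>Y\<^sub>m\<close>, for \<open>m \<ge> 1\<close>.\<close>

definition output_observable ::
  "('h::complex_inner \<Rightarrow> 'p::complex_inner list \<Rightarrow> 't::complex_inner) \<Rightarrow> ('t \<Rightarrow> 'h) \<Rightarrow>
   ('p \<Rightarrow> 'p) \<Rightarrow> nat \<Rightarrow> 'h \<Rightarrow> 'h" where
  "output_observable tens V Y m = row_conj tens V id (replicate (m - 1) id @ [Y])"

text \<open>
  For \<open>Y \<epsilon>\<^sub>j = j \<epsilon>\<^sub>j\<close>, the probability that a measurement of \<open>Y\<^sub>m\<close> in the vector state \<open>\<eta>\<close> yields \<open>k\<close>.
  It only involves the projection onto the eigenspace \<open>\<complex> \<epsilon>\<^sub>k\<close>, so it is meaningful even if \<open>Y\<close> is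
  unbounded, which happens for infinite \<open>d\<close>.
\<close>

definition outcome_probability ::
  "('h::complex_inner \<Rightarrow> 'p::complex_inner list \<Rightarrow> 't::complex_inner) \<Rightarrow> (nat \<Rightarrow> 'p) \<Rightarrow>
   ('t \<Rightarrow> 'h) \<Rightarrow> nat \<Rightarrow> 'h \<Rightarrow> nat \<Rightarrow> complex" where
  "outcome_probability tens \<epsilon> V m \<eta> k =
     cinner \<eta> (output_observable tens V (projection_onto (cspan {\<epsilon> k})) m \<eta>)"

end

theory Submission
  imports Defs
begin

text \<open>
  Write \<open>W \<xi> [\<eta>\<^sub>1, \<dots>, \<eta>\<^sub>n]\<close> for the image of \<open>\<xi> \<otimes> \<eta>\<^sub>1 \<otimes> \<dots> \<otimes> \<eta>\<^sub>n\<close> under \<open>V\<^sup>(\<^sup>n\<^sup>)\<close>. As the process is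
  unital, \<open>V\<^sup>(\<^sup>n\<^sup>)\<close> is a surjective isometry, so its adjoint is its inverse and for each \<open>n\<close> the
  vectors \<open>W \<xi> [\<eta>\<^sub>1, \<dots>, \<eta>\<^sub>n]\<close> are total in \<open>\<H>\<close>. On them \<open>X\<^sub>n\<close> replaces \<open>\<xi>\<close> by \<open>X \<xi>\<close>, and, since
  \<open>W \<xi> (\<eta>s @ \<zeta>s) = W (W \<xi> \<zeta>s) \<eta>s\<close>, the observable \<open>Y\<^sub>m\<close> with \<open>m \<le> n\<close> replaces \<open>\<eta>\<^sub>m\<close> by \<open>Y \<eta>\<^sub>m\<close>.
  Changes in different places commute. The range of \<open>V\<^sub>\<alpha>\<close> consists of the vectors
  \<open>W \<xi> [\<epsilon>\<^bsub>\<alpha>\<^sub>1\<^esub>, \<dots>, \<epsilon>\<^bsub>\<alpha>\<^sub>n\<^esub>]\<close>, which are fixed when the projection onto \<open>\<complex> \<epsilon>\<^bsub>\<alpha>\<^sub>m\<^esub>\<close> is applied in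
  place \<open>m\<close>.
\<close>

section \<open>Complex inner product spaces\<close>

lemma cinner_add_left: "cinner (x + y) z = cinner x z + cinner y z"
  for x y z :: "'a::complex_inner"
  by (metis cinner_add_right cinner_commute complex_cnj_add)

lemma cinner_scaleC_left: "cinner (c *\<^sub>C x) y = cnj c * cinner x y"
  for x y :: "'a::complex_inner"
  by (metis cinner_commute cinner_scaleC_right complex_cnj_mult)

lemma cinner_zero_right [simp]: "cinner x 0 = 0" for x :: "'a::complex_inner"
  using cinner_add_right[of x 0 0] by simp

lemma cinner_zero_left [simp]: "cinner 0 x = 0" for x :: "'a::complex_inner"
  using cinner_add_left[of 0 0 x] by simp

lemma cinner_minus_right: "cinner x (- y) = - cinner x y" for x y :: "'a::complex_inner"
  using cinner_add_right[of x y "- y"] by (simp add: eq_neg_iff_add_eq_0 add.commute)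

lemma cinner_diff_right: "cinner x (y - z) = cinner x y - cinner x z"
  for x y z :: "'a::complex_inner"
  using cinner_add_right[of x y "- z"] by (simp add: cinner_minus_right)

lemma cinner_diff_left: "cinner (x - y) z = cinner x z - cinner y z"
  for x y z :: "'a::complex_inner"
  by (metis cinner_diff_right cinner_commute complex_cnj_diff)

lemma cinner_sum_right: "cinner x (\<Sum>i\<in>I. f i) = (\<Sum>i\<in>I. cinner x (f i))"
  for x :: "'a::complex_inner"
  by (induction I rule: infinite_finite_induct) (auto simp: cinner_add_right)

lemma cinner_sum_left: "cinner (\<Sum>i\<in>I. f i) x = (\<Sum>i\<in>I. cinner (f i) x)"
  for x :: "'a::complex_inner"
  by (induction I rule: infinite_finite_induct) (auto simp: cinner_add_left)

lemma cinner_self: "cinner x x = complex_of_real ((norm x)\<^sup>2)" for x :: "'a::complex_inner"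
proof -
  have "Im (cinner x x) = 0"
    using arg_cong[OF cinner_commute[of x x], of Im] by simp
  moreover have "Re (cinner x x) = (norm x)\<^sup>2"
    by (simp add: inner_eq_Re_cinner[symmetric] power2_norm_eq_inner)
  ultimately show ?thesis
    by (simp add: complex_eq_iff)
qed

lemma cinner_self_eq_0_iff [simp]: "cinner x x = 0 \<longleftrightarrow> x = 0" for x :: "'a::complex_inner"
  by (simp add: cinner_self)

text \<open>Since the real part of \<open>cinner\<close> is the given real inner product, its
  imaginary part is recovered by rotating the second argument by \<open>\<i>\<close>. Real
  polarisation thereby determines the complex inner product.\<close>

lemma cinner_eq_Complex_inner: "cinner x y = Complex (inner x y) (- inner x (\<i> *\<^sub>C y))"
  for x y :: "'a::complex_inner"
  by (simp add: inner_eq_Re_cinner cinner_scaleC_right complex_eq_iff)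

lemma norm_scaleC: "norm (c *\<^sub>C x) = cmod c * norm x" for x :: "'a::complex_inner"
proof -
  have "complex_of_real ((norm (c *\<^sub>C x))\<^sup>2) = (c * cnj c) * complex_of_real ((norm x)\<^sup>2)"
    by (simp only: cinner_self[symmetric] cinner_scaleC_left cinner_scaleC_right mult_ac)
  also have "\<dots> = complex_of_real ((cmod c * norm x)\<^sup>2)"
    by (simp only: complex_norm_square[symmetric] of_real_mult[symmetric] power_mult_distrib)
  finally have "(norm (c *\<^sub>C x))\<^sup>2 = (cmod c * norm x)\<^sup>2"
    using of_real_eq_iff by blast
  then show ?thesis
    by (rule power2_eq_imp_eq) auto
qed

lemma bounded_linear_scaleC: "bounded_linear (\<lambda>x::'a::complex_inner. c *\<^sub>C x)"
  by (rule bounded_linear_intro[where K = "cmod c"])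
     (simp_all add: scaleC_add_right scaleR_scaleC scaleC_scaleC mult.commute norm_scaleC)

section \<open>Closures of complex spans\<close>

lemma csubspace_closure:
  fixes S :: "'a::complex_inner set"
  assumes "csubspace S"
  shows "csubspace (closure S)"
proof (rule complex_vector.subspaceI)
  show "0 \<in> closure S"
    using complex_vector.subspace_0[OF assms] closure_subset by blast
next
  fix x y assume "x \<in> closure S" "y \<in> closure S"
  then obtain f g where "\<forall>n. f n \<in> S" "f \<longlonglongrightarrow> x" "\<forall>n. g n \<in> S" "g \<longlonglongrightarrow> y"
    unfolding closure_sequential by blast
  then have "\<forall>n. f n + g n \<in> S" "(\<lambda>n. f n + g n) \<longlonglongrightarrow> x + y"
    by (auto intro: complex_vector.subspace_add[OF assms] tendsto_add)
  then show "x + y \<in> closure S"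
    unfolding closure_sequential by (intro exI[of _ "\<lambda>n. f n + g n"] conjI)
next
  fix c x assume "x \<in> closure S"
  then obtain f where "\<forall>n. f n \<in> S" "f \<longlonglongrightarrow> x"
    unfolding closure_sequential by blast
  then have "\<forall>n. c *\<^sub>C f n \<in> S" "(\<lambda>n. c *\<^sub>C f n) \<longlonglongrightarrow> c *\<^sub>C x"
    by (auto intro: complex_vector.subspace_scale[OF assms]
        bounded_linear.tendsto[OF bounded_linear_scaleC])
  then show "c *\<^sub>C x \<in> closure S"
    unfolding closure_sequential by (intro exI[of _ "\<lambda>n. c *\<^sub>C f n"] conjI)
qed

lemma csubspace_closure_cspan: "csubspace (closure (cspan G))"
  by (intro csubspace_closure complex_vector.subspace_span)

lemma closure_cspan_base: "x \<in> G \<Longrightarrow> x \<in> closure (cspan G)"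
  using closure_subset complex_vector.span_base by blast

lemma closure_cspan_minimal:
  assumes "G \<subseteq> M" "csubspace M" "closed M"
  shows "closure (cspan G) \<subseteq> M"
  using assms by (intro closure_minimal complex_vector.span_minimal)

text \<open>Gram-Schmidt, with membership in the span of \<open>E\<close> expressed by the Fourier expansion.\<close>

lemma finite_orthonormal_expansion:
  fixes S :: "'a::complex_inner set"
  assumes "finite S"
  shows "\<exists>E. finite E \<and> (\<forall>e\<in>E. \<forall>e'\<in>E. cinner e e' = (if e = e' then 1 else 0)) \<and>
    (\<forall>b\<in>S. b = (\<Sum>e\<in>E. cinner e b *\<^sub>C e))"
  using assms
proof induction
  case empty
  show ?case by (intro exI[of _ "{}"]) auto
next
  case (insert x S)
  then obtain E where E: "finite E"
    "\<And>e e'. e \<in> E \<Longrightarrow> e' \<in> E \<Longrightarrow> cinner e e' = (if e = e' then 1 else 0)"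
    "\<And>b. b \<in> S \<Longrightarrow> b = (\<Sum>e\<in>E. cinner e b *\<^sub>C e)"
    by auto
  \<comment> \<open>\<open>r\<close> is the component of \<open>x\<close> orthogonal to
    \<open>E\<close>. If it vanishes, \<open>E\<close> already expands \<open>x\<close>; otherwise
    its normalisation \<open>f\<close> is the new member of the family.\<close>
  define r where "r = x - (\<Sum>e\<in>E. cinner e x *\<^sub>C e)"
  have orth: "cinner e r = 0" if "e \<in> E" for e
  proof -
    have "(\<Sum>e'\<in>E. cinner e' x * cinner e e') = (\<Sum>e'\<in>E. if e = e' then cinner e' x else 0)"
      by (rule sum.cong) (use E(2) that in auto)
    then show ?thesis
      using E(1) that by (simp add: r_def cinner_diff_right cinner_sum_right cinner_scaleC_right)
  qed
  show ?case
  proof (cases "r = 0")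
    case True
    then show ?thesis
      using E by (intro exI[of _ E]) (auto simp: r_def)
  next
    case False
    define f where "f = complex_of_real (inverse (norm r)) *\<^sub>C r"
    have ff: "cinner f f = 1"
      using False by (simp add: cinner_self) (simp add: f_def norm_scaleC norm_inverse)
    have ef: "cinner e f = 0" if "e \<in> E" for e
      using orth[OF that] by (simp add: f_def cinner_scaleC_right)
    have fe: "cinner f e = 0" if "e \<in> E" for e
      using ef[OF that] cinner_commute[of f e] by simp
    have nin: "f \<notin> E"
      using ff ef by force
    have span_f: "cinner f (\<Sum>e\<in>E. c e *\<^sub>C e) = 0" for c
      by (simp add: cinner_sum_right cinner_scaleC_right fe)
    have x: "x = (\<Sum>e\<in>insert f E. cinner e x *\<^sub>C e)"
    proof -
      have "x = r + (\<Sum>e\<in>E. cinner e x *\<^sub>C e)"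
        by (simp add: r_def)
      then have "cinner f x = cinner f r"
        using span_f by (metis cinner_add_right add.right_neutral)
      then have "cinner f x = complex_of_real (norm r)"
        using False by (simp add: f_def cinner_scaleC_left cinner_self power2_eq_square)
      then have "cinner f x *\<^sub>C f = r"
        using False by (simp add: f_def scaleC_scaleC)
      then show ?thesis
        using E(1) nin by (simp add: r_def)
    qed
    have old: "b = (\<Sum>e\<in>insert f E. cinner e b *\<^sub>C e)" if "b \<in> S" for b
    proof -
      have "cinner f b = 0"
        using E(3)[OF that] span_f by metis
      then show ?thesis
        using E(1) E(3)[OF that] nin by simp
    qed
    show ?thesis
      using E(1,2) ff ef fe nin x old by (intro exI[of _ "insert f E"]) auto
  qed
qed

text \<open>Parseval's identity over a finite family: \<open>b\<close> may be arbitrary, as its part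
  orthogonal to \<open>E\<close> does not meet \<open>b'\<close>.\<close>

lemma cinner_finite_orthonormal_expansion:
  fixes b b' :: "'a::complex_inner"
  assumes "b' = (\<Sum>e\<in>E. cinner e b' *\<^sub>C e)"
  shows "cinner b b' = (\<Sum>e\<in>E. cnj (cinner e b) * cinner e b')"
proof -
  have "cinner b b' = cinner b (\<Sum>e\<in>E. cinner e b' *\<^sub>C e)"
    using assms by simp
  also have "\<dots> = (\<Sum>e\<in>E. cnj (cinner e b) * cinner e b')"
    by (simp add: cinner_sum_right cinner_scaleC_right mult.commute flip: cinner_commute)
  finally show ?thesis .
qed


section \<open>Bounded operators and isometries on subspaces\<close>

lemma clinear_on_add: "clinear_on S f \<Longrightarrow> x \<in> S \<Longrightarrow> y \<in> S \<Longrightarrow> f (x + y) = f x + f y"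
  by (simp add: clinear_on_def)

lemma clinear_on_scaleC: "clinear_on S f \<Longrightarrow> x \<in> S \<Longrightarrow> f (c *\<^sub>C x) = c *\<^sub>C f x"
  by (simp add: clinear_on_def)

lemma clinear_on_zero: "clinear_on S f \<Longrightarrow> csubspace S \<Longrightarrow> f 0 = 0"
  using clinear_on_scaleC[of S f 0 0] by (simp add: complex_vector.subspace_0)

lemma clinear_on_diff:
  assumes "clinear_on S f" "csubspace S" "x \<in> S" "y \<in> S"
  shows "f (x - y) = f x - f y"
  using clinear_on_add[OF assms(1,3), of "(-1) *\<^sub>C y"] clinear_on_scaleC[OF assms(1,4), of "-1"]
    complex_vector.subspace_scale[OF assms(2,4), of "-1"] by simp

lemma clinear_on_sum:
  assumes "clinear_on S f" "csubspace S" "\<And>i. i \<in> I \<Longrightarrow> g i \<in> S"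
  shows "f (\<Sum>i\<in>I. c i *\<^sub>C g i) = (\<Sum>i\<in>I. c i *\<^sub>C f (g i))"
  using assms(3)
proof (induction I rule: infinite_finite_induct)
  case (insert x I)
  then show ?case
    by (simp add: clinear_on_add[OF assms(1)] clinear_on_scaleC[OF assms(1)]
        complex_vector.subspace_sum[OF assms(2)] complex_vector.subspace_scale[OF assms(2)])
qed (use clinear_on_zero[OF assms(1,2)] in auto)

lemma bounded_clinear_onD: "bounded_clinear_on S A \<Longrightarrow> clinear_on S A"
  by (simp add: bounded_clinear_on_def)

lemma bounded_clinear_on_bound:
  assumes "bounded_clinear_on S A"
  obtains K where "0 \<le> K" "\<And>x. x \<in> S \<Longrightarrow> norm (A x) \<le> K * norm x"
proof -
  obtain K where K: "\<And>x. x \<in> S \<Longrightarrow> norm (A x) \<le> K * norm x"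
    using assms by (auto simp: bounded_clinear_on_def)
  have "norm (A x) \<le> \<bar>K\<bar> * norm x" if "x \<in> S" for x
    by (rule order_trans[OF K[OF that]]) (simp add: mult_right_mono)
  then show ?thesis
    using that[of "\<bar>K\<bar>"] by simp
qed

text \<open>The norm bound applied to differences is a Lipschitz estimate. Uniform continuity,
  rather than continuity alone, is what permits extension to a closure later on.\<close>

lemma bounded_clinear_on_uniformly_continuous:
  assumes "bounded_clinear_on S A" "csubspace S"
  shows "uniformly_continuous_on S A"
proof -
  obtain K where K: "0 \<le> K" "\<And>x. x \<in> S \<Longrightarrow> norm (A x) \<le> K * norm x"
    using bounded_clinear_on_bound[OF assms(1)] by blast
  have "K-lipschitz_on S A"
  proof (rule lipschitz_onI)
    fix x y assume "x \<in> S" "y \<in> S"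
    then show "dist (A x) (A y) \<le> K * dist x y"
      using K(2)[of "x - y"] clinear_on_diff[OF bounded_clinear_onD[OF assms(1)] assms(2)]
        complex_vector.subspace_diff[OF assms(2)] by (simp add: dist_norm)
  qed (use K in auto)
  then show ?thesis
    by (rule lipschitz_on_uniformly_continuous)
qed

lemma bounded_clinear_on_continuous:
  "bounded_clinear_on S A \<Longrightarrow> csubspace S \<Longrightarrow> continuous_on S A"
  by (intro uniformly_continuous_imp_continuous bounded_clinear_on_uniformly_continuous)

lemma bounded_clinear_on_comp:
  assumes A: "bounded_clinear_on S A" and B: "bounded_clinear_on T B" and "A ` S \<subseteq> T"
  shows "bounded_clinear_on S (B \<circ> A)"
proof -
  obtain K where K: "\<And>x. x \<in> S \<Longrightarrow> norm (A x) \<le> K * norm x"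
    using bounded_clinear_on_bound[OF A] by blast
  obtain L where L: "0 \<le> L" "\<And>x. x \<in> T \<Longrightarrow> norm (B x) \<le> L * norm x"
    using bounded_clinear_on_bound[OF B] by blast
  have "norm (B (A x)) \<le> (L * K) * norm x" if "x \<in> S" for x
  proof -
    have "norm (B (A x)) \<le> L * norm (A x)"
      using L(2) that assms(3) by blast
    also have "\<dots> \<le> L * (K * norm x)"
      using K that L(1) by (simp add: mult_left_mono)
    finally show ?thesis by (simp add: mult.assoc)
  qed
  moreover have "clinear_on S (B \<circ> A)"
    using bounded_clinear_onD[OF A] bounded_clinear_onD[OF B] assms(3)
    by (auto simp: clinear_on_def image_subset_iff)
  ultimately show ?thesis
    by (auto simp: bounded_clinear_on_def)
qed

lemma bounded_clinear_on_diff: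
  assumes A: "bounded_clinear_on S A" and B: "bounded_clinear_on S B"
  shows "bounded_clinear_on S (\<lambda>x. A x - B x)"
proof -
  obtain K where K: "\<And>x. x \<in> S \<Longrightarrow> norm (A x) \<le> K * norm x"
    using bounded_clinear_on_bound[OF A] by blast
  obtain L where L: "\<And>x. x \<in> S \<Longrightarrow> norm (B x) \<le> L * norm x"
    using bounded_clinear_on_bound[OF B] by blast
  have "norm (A x - B x) \<le> (K + L) * norm x" if "x \<in> S" for x
    using K[OF that] L[OF that] norm_triangle_ineq4[of "A x" "B x"]
    by (simp add: algebra_simps)
  moreover have "clinear_on S (\<lambda>x. A x - B x)"
    using bounded_clinear_onD[OF A] bounded_clinear_onD[OF B]
    by (simp add: clinear_on_def complex_vector.scale_right_diff_distrib)
  ultimately show ?thesis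
    by (auto simp: bounded_clinear_on_def)
qed

text \<open>The density principle used throughout: linearity carries the inclusion from
  \<open>G\<close> to its span, continuity and closedness of \<open>M\<close> carry it to the
  closure.\<close>

lemma bounded_clinear_on_total_image_subset:
  assumes A: "bounded_clinear_on (closure (cspan G)) A"
    and M: "csubspace M" "closed M" and G: "A ` G \<subseteq> M"
  shows "A ` closure (cspan G) \<subseteq> M"
proof (rule image_closure_subset)
  show "continuous_on (closure (cspan G)) A"
    using A csubspace_closure_cspan by (rule bounded_clinear_on_continuous)
  have lin: "clinear_on (cspan G) A"
    using bounded_clinear_onD[OF A] closure_subset[of "cspan G"]
    by (simp add: clinear_on_def subset_iff)
  have "A x \<in> M" if "x \<in> cspan G" for x
  proof -
    \<comment> \<open>Membership in the span is carried through the induction because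
      \<open>A\<close> is known to be linear only there.\<close>
    have "x \<in> cspan G \<and> A x \<in> M"
      using that
    proof (induction rule: complex_vector.span_induct_alt)
      case base
      show ?case
        using clinear_on_zero[OF lin] M(1)
        by (simp add: complex_vector.subspace_0 complex_vector.span_zero complex_vector.subspace_span)
    next
      case (step c x y)
      then have x: "x \<in> cspan G" "A x \<in> M"
        using G by (auto intro: complex_vector.span_base)
      then have "A (c *\<^sub>C x + y) = c *\<^sub>C A x + A y"
        using step by (simp add: clinear_on_add[OF lin] clinear_on_scaleC[OF lin]
            complex_vector.span_scale)
      then show ?case
        using x step M(1) by (simp add: complex_vector.span_add complex_vector.span_scale
            complex_vector.subspace_add complex_vector.subspace_scale)
    qed
    then show ?thesis ..
  qed
  then show "A ` cspan G \<subseteq> M" by blast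
qed (use M in auto)

text \<open>The density principle for the difference of the two operators and the closed subspace
  \<open>{0}\<close>.\<close>

lemma bounded_clinear_on_total_eq:
  fixes A B :: "'a::complex_inner \<Rightarrow> 'b::complex_inner"
  assumes "bounded_clinear_on (closure (cspan G)) A" "bounded_clinear_on (closure (cspan G)) B"
    and "\<And>g. g \<in> G \<Longrightarrow> A g = B g" and "x \<in> closure (cspan G)"
  shows "A x = B x"
proof -
  have "csubspace {0 :: 'b}"
    by (simp add: complex_vector.subspace_def)
  moreover have "(\<lambda>x. A x - B x) ` G \<subseteq> {0}"
    using assms(3) by auto
  ultimately have "(\<lambda>x. A x - B x) ` closure (cspan G) \<subseteq> {0}"
    by (intro bounded_clinear_on_total_image_subset[OF bounded_clinear_on_diff[OF assms(1,2)]]) auto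
  then show ?thesis
    using assms(4) by auto
qed

section \<open>Isometries, their adjoints and their ranges\<close>

lemma isometry_on_bounded: "isometry_on S f \<Longrightarrow> bounded_clinear_on S f"
  by (auto simp: isometry_on_def bounded_clinear_on_def intro!: exI[of _ 1])

text \<open>Polarisation: norms of sums determine the real inner product, and complex linearity
  moves the factor \<open>\<i>\<close> through \<open>f\<close> to give the imaginary part.\<close>

lemma isometry_on_cinner:
  assumes f: "isometry_on S f" and S: "csubspace S" and "x \<in> S" "y \<in> S"
  shows "cinner (f x) (f y) = cinner x y"
proof -
  have lin: "clinear_on S f" and nrm: "\<And>x. x \<in> S \<Longrightarrow> norm (f x) = norm x"
    using f by (auto simp: isometry_on_def)
  have inner: "inner (f u) (f v) = inner u v" if "u \<in> S" "v \<in> S" for u v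
    using that nrm[of "u + v"] by (simp add: dot_norm nrm clinear_on_add[OF lin, symmetric]
        complex_vector.subspace_add[OF S])
  have "\<i> *\<^sub>C f y = f (\<i> *\<^sub>C y)"
    using assms(4) by (simp add: clinear_on_scaleC[OF lin])
  then show ?thesis
    using assms by (simp add: cinner_eq_Complex_inner inner complex_vector.subspace_scale)
qed

text \<open>By preservation of inner products \<open>x\<close> satisfies the defining condition of
  the adjoint. Any other candidate \<open>z\<close> equals \<open>x\<close>, since
  \<open>z - x\<close> can be used as the test vector.\<close>

lemma adjoint_on_isometry:
  assumes "isometry_on S f" "csubspace S" "x \<in> S"
  shows "adjoint_on S f (f x) = x"
  unfolding adjoint_on_def
proof (rule the_equality)
  show "x \<in> S \<and> (\<forall>y\<in>S. cinner y x = cinner (f y) (f x))"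
    using isometry_on_cinner[OF assms(1,2)] assms(3) by simp
next
  fix z assume z: "z \<in> S \<and> (\<forall>y\<in>S. cinner y z = cinner (f y) (f x))"
  then have "cinner (z - x) z = cinner (z - x) x"
    using isometry_on_cinner[OF assms(1,2)] assms(3) complex_vector.subspace_diff[OF assms(2)]
    by metis
  then have "cinner (z - x) (z - x) = 0"
    by (simp add: cinner_diff_right)
  then show "z = x" by simp
qed

text \<open>Every vector is some \<open>f x\<close> and the adjoint returns \<open>x\<close>, so the
  adjoint is the inverse of \<open>f\<close> and inherits linearity and norm preservation.\<close>

lemma adjoint_on_surj_isometry:
  assumes f: "isometry_on S f" and S: "csubspace S" and surj: "f ` S = UNIV"
  shows "isometry_on UNIV (adjoint_on S f)" and "range (adjoint_on S f) \<subseteq> S"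
proof -
  note adj = adjoint_on_isometry[OF f S]
  have lin: "clinear_on S f" and nrm: "\<And>x. x \<in> S \<Longrightarrow> norm (f x) = norm x"
    using f by (auto simp: isometry_on_def)
  have preimage: "\<exists>x\<in>S. y = f x" for y
    using surj by blast
  have "adjoint_on S f (y + y') = adjoint_on S f y + adjoint_on S f y'" for y y'
    using preimage[of y] preimage[of y']
    by (auto simp: adj complex_vector.subspace_add[OF S] simp flip: clinear_on_add[OF lin])
  moreover have "adjoint_on S f (c *\<^sub>C y) = c *\<^sub>C adjoint_on S f y" for c y
    using preimage[of y]
    by (auto simp: adj complex_vector.subspace_scale[OF S] simp flip: clinear_on_scaleC[OF lin])
  moreover have "norm (adjoint_on S f y) = norm y" for y
    using preimage[of y] by (auto simp: adj nrm)
  ultimately show "isometry_on UNIV (adjoint_on S f)"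
    by (auto simp: isometry_on_def clinear_on_def)
  show "range (adjoint_on S f) \<subseteq> S"
    using adj preimage by (metis image_subsetI)
qed

text \<open>A convergent sequence of images has Cauchy preimages, because distances are preserved;
  completeness and closedness of \<open>S\<close> provide their limit, and continuity identifies its
  image.\<close>

lemma closed_isometry_image:
  fixes f :: "'a::chilbert_space \<Rightarrow> 'b::complex_inner"
  assumes f: "isometry_on S f" and S: "csubspace S" and "closed S"
  shows "closed (f ` S)"
  unfolding closed_sequential_limits
proof (intro allI impI, elim conjE)
  fix y l assume "\<forall>n. y n \<in> f ` S" and lim: "y \<longlonglongrightarrow> l"
  then have "\<forall>n. \<exists>u. u \<in> S \<and> y n = f u"
    by blast
  then obtain x where x: "\<And>n. x n \<in> S" "\<And>n. y n = f (x n)"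
    unfolding choice_iff by blast
  have lin: "clinear_on S f" and nrm: "\<And>x. x \<in> S \<Longrightarrow> norm (f x) = norm x"
    using f by (auto simp: isometry_on_def)
  have "dist (y m) (y n) = dist (x m) (x n)" for m n
    using x nrm[of "x m - x n"] complex_vector.subspace_diff[OF S]
    by (simp add: dist_norm clinear_on_diff[OF lin S])
  then have "Cauchy x"
    using LIMSEQ_imp_Cauchy[OF lim] by (simp add: Cauchy_def)
  then obtain z where z: "x \<longlonglongrightarrow> z"
    using Cauchy_convergent_iff convergent_def by blast
  then have "z \<in> S"
    using closed_sequentially[OF assms(3)] x(1) by blast
  moreover have "(\<lambda>n. f (x n)) \<longlonglongrightarrow> f z"
    using bounded_clinear_on_continuous[OF isometry_on_bounded[OF f] S] z calculation x(1)
    by (auto intro: continuous_on_tendsto_compose)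
  then have "l = f z"
    using LIMSEQ_unique[OF lim] by (simp add: x(2)[abs_def])
  ultimately show "l \<in> f ` S" by blast
qed

lemma csubspace_clinear_image:
  assumes f: "clinear_on S f" and S: "csubspace S"
  shows "csubspace (f ` S)"
proof (rule complex_vector.subspaceI)
  show "0 \<in> f ` S"
    using clinear_on_zero[OF f S] complex_vector.subspace_0[OF S] by force
next
  fix x y assume "x \<in> f ` S" "y \<in> f ` S"
  then show "x + y \<in> f ` S"
    by (auto simp: complex_vector.subspace_add[OF S] simp flip: clinear_on_add[OF f])
next
  fix c x assume "x \<in> f ` S"
  then show "c *\<^sub>C x \<in> f ` S"
    by (auto simp: complex_vector.subspace_scale[OF S] simp flip: clinear_on_scaleC[OF f])
qed

section \<open>Constructing operators from values on a total family\<close>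

lemma cinner_linear_combination:
  fixes f :: "'i \<Rightarrow> 'a::complex_inner"
  shows "cinner (\<Sum>i\<in>J. c i *\<^sub>C f i) (\<Sum>i\<in>J. c i *\<^sub>C f i) =
    (\<Sum>i\<in>J. \<Sum>j\<in>J. cnj (c i) * c j * cinner (f i) (f j))"
  by (simp only: cinner_sum_left cinner_scaleC_left)
    (simp only: cinner_sum_right cinner_scaleC_right sum_distrib_left mult.assoc)

text \<open>The norm of a linear combination depends only on the coefficients and the Gram
  matrix.\<close>

lemma norm_linear_combination_eq:
  fixes f :: "'i \<Rightarrow> 'a::complex_inner" and g :: "'i \<Rightarrow> 'b::complex_inner"
  assumes "\<And>i j. i \<in> J \<Longrightarrow> j \<in> J \<Longrightarrow> cinner (f i) (f j) = cinner (g i) (g j)"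
  shows "norm (\<Sum>i\<in>J. c i *\<^sub>C f i) = norm (\<Sum>i\<in>J. c i *\<^sub>C g i)"
proof -
  have "cinner (\<Sum>i\<in>J. c i *\<^sub>C f i) (\<Sum>i\<in>J. c i *\<^sub>C f i) =
      cinner (\<Sum>i\<in>J. c i *\<^sub>C g i) (\<Sum>i\<in>J. c i *\<^sub>C g i)"
    unfolding cinner_linear_combination using assms by simp
  then have "(norm (\<Sum>i\<in>J. c i *\<^sub>C f i))\<^sup>2 = (norm (\<Sum>i\<in>J. c i *\<^sub>C g i))\<^sup>2"
    unfolding cinner_self of_real_eq_iff .
  then show ?thesis
    by (rule power2_eq_imp_eq) auto
qed

text \<open>On the span norms are read off from the Gram matrix of \<open>G\<close>, which
  \<open>A\<close> preserves; equality of norms then passes to the closure by continuity.\<close>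

lemma isometry_on_total:
  assumes A: "bounded_clinear_on (closure (cspan G)) A"
    and G: "\<And>x y. x \<in> G \<Longrightarrow> y \<in> G \<Longrightarrow> cinner (A x) (A y) = cinner x y"
  shows "isometry_on (closure (cspan G)) A"
proof -
  note lin = bounded_clinear_onD[OF A]
  have span: "norm (A x) = norm x" if x: "x \<in> cspan G" for x
  proof -
    obtain T c where T: "finite T" "T \<subseteq> G" "x = (\<Sum>a\<in>T. c a *\<^sub>C a)"
      using x unfolding complex_vector.span_explicit by blast
    have "A x = (\<Sum>a\<in>T. c a *\<^sub>C A a)"
      unfolding T(3) using T(2)
      by (intro clinear_on_sum[OF lin csubspace_closure_cspan]) (auto intro: closure_cspan_base)
    then show ?thesis
      unfolding T(3) using T(2) by (auto intro!: norm_linear_combination_eq G)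
  qed
  have "continuous_on (closure (cspan G)) (\<lambda>x. norm (A x) - norm x)"
    by (intro continuous_intros bounded_clinear_on_continuous[OF A csubspace_closure_cspan])
  then have "norm (A x) - norm x = 0" if "x \<in> closure (cspan G)" for x
    by (rule continuous_constant_on_closure) (use span that in auto)
  then show ?thesis
    using lin by (simp add: isometry_on_def)
qed

text \<open>A uniformly continuous map into a complete space extends to the closure. Linearity and
  the norm bound survive as limits along sequences from \<open>S\<close>.\<close>

lemma bounded_clinear_on_closure_extension:
  fixes f :: "'a::complex_inner \<Rightarrow> 'b::chilbert_space"
  assumes f: "bounded_clinear_on S f" and S: "csubspace S"
  obtains A where "bounded_clinear_on (closure S) A" "\<And>x. x \<in> S \<Longrightarrow> A x = f x"
proof -
  obtain K where K: "0 \<le> K" "\<And>x. x \<in> S \<Longrightarrow> norm (f x) \<le> K * norm x"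
    using bounded_clinear_on_bound[OF f] by blast
  note lin = bounded_clinear_onD[OF f]
  have "uniformly_continuous_on S f"
    using f S by (rule bounded_clinear_on_uniformly_continuous)
  then obtain A where uA: "uniformly_continuous_on (closure S) A" and Af: "\<And>x. x \<in> S \<Longrightarrow> f x = A x"
    using uniformly_continuous_on_extension_on_closure by metis
  have cA: "continuous_on (closure S) A"
    using uA by (rule uniformly_continuous_imp_continuous)
  have approx: "\<exists>u. (\<forall>n. u n \<in> S) \<and> u \<longlonglongrightarrow> x \<and> (\<lambda>n. f (u n)) \<longlonglongrightarrow> A x" if x: "x \<in> closure S" for x
  proof -
    obtain u where u: "\<forall>n. u n \<in> S" "u \<longlonglongrightarrow> x"
      using x unfolding closure_sequential by blast
    have "(\<lambda>n. A (u n)) \<longlonglongrightarrow> A x"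
      using u x closure_subset[of S] by (intro continuous_on_tendsto_compose[OF cA]) (auto intro!: eventuallyI)
    then show ?thesis
      using u Af by auto
  qed
  \<comment> \<open>\<open>A x\<close> can be computed from any approximating sequence, in
    particular from sums and multiples of sequences chosen for other points.\<close>
  have lim_unique: "A x = l"
    if "\<forall>n. u n \<in> S" "u \<longlonglongrightarrow> x" "(\<lambda>n. f (u n)) \<longlonglongrightarrow> l" for u x l
  proof -
    have "x \<in> closure S"
      using that unfolding closure_sequential by blast
    then have "(\<lambda>n. A (u n)) \<longlonglongrightarrow> A x"
      using that closure_subset[of S] by (intro continuous_on_tendsto_compose[OF cA]) (auto intro!: eventuallyI)
    then show ?thesis
      using that Af by (auto intro: LIMSEQ_unique)
  qed
  have add: "A (x + y) = A x + A y" if x: "x \<in> closure S" "y \<in> closure S" for x y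
  proof -
    obtain u v where u: "\<forall>n. u n \<in> S" "u \<longlonglongrightarrow> x" "(\<lambda>n. f (u n)) \<longlonglongrightarrow> A x"
      and v: "\<forall>n. v n \<in> S" "v \<longlonglongrightarrow> y" "(\<lambda>n. f (v n)) \<longlonglongrightarrow> A y"
      using approx x by metis
    show ?thesis
    proof (rule lim_unique)
      show "\<forall>n. u n + v n \<in> S"
        using u v by (simp add: complex_vector.subspace_add[OF S])
      show "(\<lambda>n. u n + v n) \<longlonglongrightarrow> x + y"
        using u v by (intro tendsto_add)
      show "(\<lambda>n. f (u n + v n)) \<longlonglongrightarrow> A x + A y"
        using u v by (simp add: clinear_on_add[OF lin] tendsto_add)
    qed
  qed
  have scale: "A (c *\<^sub>C x) = c *\<^sub>C A x" if x: "x \<in> closure S" for c x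
  proof -
    obtain u where u: "\<forall>n. u n \<in> S" "u \<longlonglongrightarrow> x" "(\<lambda>n. f (u n)) \<longlonglongrightarrow> A x"
      using approx x by metis
    show ?thesis
    proof (rule lim_unique)
      show "\<forall>n. c *\<^sub>C u n \<in> S"
        using u by (simp add: complex_vector.subspace_scale[OF S])
      show "(\<lambda>n. c *\<^sub>C u n) \<longlonglongrightarrow> c *\<^sub>C x"
        using u by (intro bounded_linear.tendsto[OF bounded_linear_scaleC])
      show "(\<lambda>n. f (c *\<^sub>C u n)) \<longlonglongrightarrow> c *\<^sub>C A x"
        using u by (simp add: clinear_on_scaleC[OF lin] bounded_linear.tendsto[OF bounded_linear_scaleC])
    qed
  qed
  have "norm (A x) \<le> K * norm x" if x: "x \<in> closure S" for x
  proof -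
    obtain u where u: "\<forall>n. u n \<in> S" "u \<longlonglongrightarrow> x" "(\<lambda>n. f (u n)) \<longlonglongrightarrow> A x"
      using approx x by metis
    show ?thesis
    proof (rule LIMSEQ_le)
      show "(\<lambda>n. norm (f (u n))) \<longlonglongrightarrow> norm (A x)" "(\<lambda>n. K * norm (u n)) \<longlonglongrightarrow> K * norm x"
        using u by (auto intro!: tendsto_intros)
    qed (use u K in auto)
  qed
  then have "bounded_clinear_on (closure S) A"
    using add scale by (auto simp: bounded_clinear_on_def clinear_on_def)
  then show ?thesis
    using that Af by metis
qed

text \<open>The values \<open>f i\<close> may be prescribed on a linearly dependent family
  \<open>g\<close>: the bound forces every relation among the \<open>g i\<close> to hold among the
  \<open>f i\<close>, which gives a well-defined map on the span, and then on its closure.\<close>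

lemma bounded_clinear_extension:
  fixes g :: "'i \<Rightarrow> 'a::complex_inner" and f :: "'i \<Rightarrow> 'b::chilbert_space"
  assumes bound: "\<And>J c. finite J \<Longrightarrow> J \<subseteq> I \<Longrightarrow>
    norm (\<Sum>i\<in>J. c i *\<^sub>C f i) \<le> K * norm (\<Sum>i\<in>J. c i *\<^sub>C g i)"
  obtains A where "bounded_clinear_on (closure (cspan (g ` I))) A" "\<And>i. i \<in> I \<Longrightarrow> A (g i) = f i"
proof -
  \<comment> \<open>\<open>R\<close> is the span of the pairs \<open>(g i, f i)\<close>, the graph
    of the desired operator before it is known to be single-valued.\<close>
  define R where "R x y \<longleftrightarrow> (\<exists>J c. finite J \<and> J \<subseteq> I \<and> x = (\<Sum>i\<in>J. c i *\<^sub>C g i) \<and>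
    y = (\<Sum>i\<in>J. c i *\<^sub>C f i))" for x y
  have R_bound: "norm y \<le> K * norm x" if "R x y" for x y
    using that bound by (auto simp: R_def)
  have R_base: "R (g i) (f i)" if "i \<in> I" for i
    unfolding R_def using that by (intro exI[of _ "{i}"] exI[of _ "\<lambda>_. 1"]) auto
  have R_scale: "R (c *\<^sub>C x) (c *\<^sub>C y)" if R: "R x y" for c x y
  proof -
    obtain J b where "finite J" "J \<subseteq> I" "x = (\<Sum>i\<in>J. b i *\<^sub>C g i)" "y = (\<Sum>i\<in>J. b i *\<^sub>C f i)"
      using R unfolding R_def by blast
    then show ?thesis
      unfolding R_def by (intro exI[of _ J] exI[of _ "\<lambda>i. c * b i"])
        (auto simp: complex_vector.scale_sum_right scaleC_scaleC)
  qed
  have R_add: "R (x + x') (y + y')" if R: "R x y" "R x' y'" for x x' y y'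
  proof -
    obtain J b where J: "finite J" "J \<subseteq> I" "x = (\<Sum>i\<in>J. b i *\<^sub>C g i)" "y = (\<Sum>i\<in>J. b i *\<^sub>C f i)"
      using R(1) unfolding R_def by blast
    obtain J' b' where J': "finite J'" "J' \<subseteq> I" "x' = (\<Sum>i\<in>J'. b' i *\<^sub>C g i)"
      "y' = (\<Sum>i\<in>J'. b' i *\<^sub>C f i)"
      using R(2) unfolding R_def by blast
    \<comment> \<open>Both coefficient families are padded by zero to the common index set
      \<open>J \<union> J'\<close> before being added.\<close>
    define e where "e i = (if i \<in> J then b i else 0) + (if i \<in> J' then b' i else 0)" for i
    have sums: "(\<Sum>i\<in>J \<union> J'. e i *\<^sub>C h i) = (\<Sum>i\<in>J. b i *\<^sub>C h i) + (\<Sum>i\<in>J'. b' i *\<^sub>C h i)"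
      for h :: "'i \<Rightarrow> 'c::complex_inner"
    proof -
      have "(\<Sum>i\<in>J \<union> J'. (if i \<in> J then b i else 0) *\<^sub>C h i) = (\<Sum>i\<in>J. b i *\<^sub>C h i)"
        using J J' by (intro sum.mono_neutral_cong_right) auto
      moreover have "(\<Sum>i\<in>J \<union> J'. (if i \<in> J' then b' i else 0) *\<^sub>C h i) = (\<Sum>i\<in>J'. b' i *\<^sub>C h i)"
        using J J' by (intro sum.mono_neutral_cong_right) auto
      ultimately show ?thesis
        by (simp add: e_def scaleC_add_left sum.distrib)
    qed
    show ?thesis
      unfolding R_def using J J' sums[of g] sums[of f]
      by (intro exI[of _ "J \<union> J'"] exI[of _ e]) auto
  qed
  \<comment> \<open>The difference of the two pairs has first component 0, so the bound annihilates
    \<open>y - y'\<close>.\<close>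
  have R_unique: "y = y'" if "R x y" "R x y'" for x y y'
    using R_bound[OF R_add[OF that(1) R_scale[OF that(2), of "-1"]]] by simp
  have R_zero: "R 0 0"
    unfolding R_def by (intro exI[of _ "{}"]) auto
  have R_span: "\<exists>y. R x y" if "x \<in> cspan (g ` I)" for x
    using that
  proof (induction rule: complex_vector.span_induct_alt)
    case base
    show ?case using R_zero by blast
  next
    case (step c x z)
    then show ?case using R_add R_scale R_base by blast
  qed
  define F where "F x = (THE y. R x y)" for x
  have RF: "F x = y" if "R x y" for x y
    unfolding F_def using that R_unique by blast
  have "F (x + y) = F x + F y" if "x \<in> cspan (g ` I)" "y \<in> cspan (g ` I)" for x y
    using R_span[OF that(1)] R_span[OF that(2)] R_add RF by metis
  moreover have "F (c *\<^sub>C x) = c *\<^sub>C F x" if "x \<in> cspan (g ` I)" for c x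
    using R_span[OF that] R_scale RF by metis
  moreover have "norm (F x) \<le> K * norm x" if "x \<in> cspan (g ` I)" for x
    using R_span[OF that] R_bound RF by metis
  ultimately have "bounded_clinear_on (cspan (g ` I)) F"
    by (auto simp: bounded_clinear_on_def clinear_on_def intro!: exI[of _ K])
  then obtain A where "bounded_clinear_on (closure (cspan (g ` I))) A"
    "\<And>x. x \<in> cspan (g ` I) \<Longrightarrow> A x = F x"
    using bounded_clinear_on_closure_extension complex_vector.subspace_span by metis
  then show ?thesis
    using that R_base RF by (metis complex_vector.span_base imageI)
qed

text \<open>The Gram matrix of \<open>p\<close> is that of the formal tensors of \<open>a i\<close>
  with \<open>b i\<close>. Expanding the second factors in the orthonormal family \<open>E\<close>
  splits the vector into orthogonal components, one for each \<open>e\<close>, whose squared norms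
  add up.\<close>

lemma norm_linear_combination_kernel:
  fixes a :: "'i \<Rightarrow> 'a::complex_inner" and b :: "'i \<Rightarrow> 'b::complex_inner"
    and p :: "'i \<Rightarrow> 'c::complex_inner"
  assumes p: "\<And>i j. i \<in> J \<Longrightarrow> j \<in> J \<Longrightarrow> cinner (p i) (p j) = cinner (a i) (a j) * cinner (b i) (b j)"
    and E: "\<And>i. i \<in> J \<Longrightarrow> b i = (\<Sum>e\<in>E. cinner e (b i) *\<^sub>C e)"
  shows "(norm (\<Sum>i\<in>J. c i *\<^sub>C p i))\<^sup>2 =
    (\<Sum>e\<in>E. (norm (\<Sum>i\<in>J. (c i * cinner e (b i)) *\<^sub>C a i))\<^sup>2)"
proof -
  have "cinner (\<Sum>i\<in>J. c i *\<^sub>C p i) (\<Sum>i\<in>J. c i *\<^sub>C p i) =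
      (\<Sum>i\<in>J. \<Sum>j\<in>J. \<Sum>e\<in>E. cnj (c i * cinner e (b i)) * (c j * cinner e (b j)) * cinner (a i) (a j))"
    unfolding cinner_linear_combination
  proof (intro sum.cong refl)
    fix i j assume "i \<in> J" "j \<in> J"
    then show "cnj (c i) * c j * cinner (p i) (p j) =
        (\<Sum>e\<in>E. cnj (c i * cinner e (b i)) * (c j * cinner e (b j)) * cinner (a i) (a j))"
      by (simp add: p cinner_finite_orthonormal_expansion[OF E, of j "b i"] sum_distrib_left mult_ac)
  qed
  also have "\<dots> = (\<Sum>i\<in>J. \<Sum>e\<in>E. \<Sum>j\<in>J.
      cnj (c i * cinner e (b i)) * (c j * cinner e (b j)) * cinner (a i) (a j))"
    by (intro sum.cong refl sum.swap)
  also have "\<dots> = (\<Sum>e\<in>E. \<Sum>i\<in>J. \<Sum>j\<in>J.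
      cnj (c i * cinner e (b i)) * (c j * cinner e (b j)) * cinner (a i) (a j))"
    by (rule sum.swap)
  also have "\<dots> = (\<Sum>e\<in>E. cinner (\<Sum>i\<in>J. (c i * cinner e (b i)) *\<^sub>C a i)
      (\<Sum>i\<in>J. (c i * cinner e (b i)) *\<^sub>C a i))"
    unfolding cinner_linear_combination ..
  finally show ?thesis
    unfolding cinner_self of_real_sum[symmetric] of_real_eq_iff .
qed

text \<open>The boundedness of \<open>X \<otimes> 1\<close>: expanding the \<open>b\<^sub>i\<close> in a finite orthonormal family reduces it to the
  boundedness of \<open>X\<close> on each coefficient.\<close>

lemma norm_linear_combination_kernel_le:
  fixes a :: "'i \<Rightarrow> 'a::complex_inner" and b :: "'i \<Rightarrow> 'b::complex_inner"
    and p :: "'i \<Rightarrow> 'c::complex_inner" and q :: "'i \<Rightarrow> 'd::complex_inner"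
  assumes X: "clinear_on UNIV X" "\<And>x. norm (X x) \<le> K * norm x" and "0 \<le> K" and "finite J"
    and p: "\<And>i j. i \<in> J \<Longrightarrow> j \<in> J \<Longrightarrow> cinner (p i) (p j) = cinner (a i) (a j) * cinner (b i) (b j)"
    and q: "\<And>i j. i \<in> J \<Longrightarrow> j \<in> J \<Longrightarrow>
      cinner (q i) (q j) = cinner (X (a i)) (X (a j)) * cinner (b i) (b j)"
  shows "norm (\<Sum>i\<in>J. c i *\<^sub>C q i) \<le> K * norm (\<Sum>i\<in>J. c i *\<^sub>C p i)"
proof -
  obtain E where "\<forall>y\<in>b ` J. y = (\<Sum>e\<in>E. cinner e y *\<^sub>C e)"
    using finite_orthonormal_expansion[OF finite_imageI[OF \<open>finite J\<close>, of b]] by blast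
  then have E: "\<And>i. i \<in> J \<Longrightarrow> b i = (\<Sum>e\<in>E. cinner e (b i) *\<^sub>C e)"
    by blast
  \<comment> \<open>\<open>v e\<close> is the coefficient vector at \<open>e\<close> when the second
    factors are expanded in \<open>E\<close>; by linearity, acting with \<open>X\<close> on the
    first factors replaces it by \<open>X (v e)\<close>.\<close>
  define v where "v e = (\<Sum>i\<in>J. (c i * cinner e (b i)) *\<^sub>C a i)" for e
  have Xv: "(\<Sum>i\<in>J. (c i * cinner e (b i)) *\<^sub>C X (a i)) = X (v e)" for e
    unfolding v_def by (rule clinear_on_sum[OF X(1), symmetric]) auto
  have norm_p: "(norm (\<Sum>i\<in>J. c i *\<^sub>C p i))\<^sup>2 = (\<Sum>e\<in>E. (norm (v e))\<^sup>2)"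
    unfolding v_def by (rule norm_linear_combination_kernel[OF p E])
  have "(norm (\<Sum>i\<in>J. c i *\<^sub>C q i))\<^sup>2 = (\<Sum>e\<in>E. (norm (X (v e)))\<^sup>2)"
    unfolding Xv[symmetric] by (rule norm_linear_combination_kernel[OF q E])
  also have "\<dots> \<le> (\<Sum>e\<in>E. (K * norm (v e))\<^sup>2)"
    by (intro sum_mono power_mono X(2)) simp
  also have "\<dots> = (K * norm (\<Sum>i\<in>J. c i *\<^sub>C p i))\<^sup>2"
    by (simp only: power_mult_distrib sum_distrib_left norm_p)
  finally show ?thesis
    by (rule power2_le_imp_le) (use \<open>0 \<le> K\<close> in simp)
qed


section \<open>Operators on tensor products\<close>

lemma tensor_space_eq:
  "tensor_space tens n = closure (cspan ((\<lambda>(\<xi>, \<eta>s). tens \<xi> \<eta>s) ` {(\<xi>, \<eta>s). length \<eta>s = n}))"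
proof -
  have "{tens \<xi> \<eta>s |\<xi> \<eta>s. length \<eta>s = n} = (\<lambda>(\<xi>, \<eta>s). tens \<xi> \<eta>s) ` {(\<xi>, \<eta>s). length \<eta>s = n}"
    by auto
  then show ?thesis
    by (simp add: tensor_space_def)
qed

lemma csubspace_tensor_space: "csubspace (tensor_space tens n)"
  by (simp add: tensor_space_def csubspace_closure_cspan)

lemma closed_tensor_space: "closed (tensor_space tens n)"
  by (simp add: tensor_space_def)

lemma tens_in_tensor_space: "length \<eta>s = n \<Longrightarrow> tens \<xi> \<eta>s \<in> tensor_space tens n"
  unfolding tensor_space_def by (rule closure_cspan_base) blast

lemma bounded_clinear_on_tensor_space_image_subset:
  assumes "bounded_clinear_on (tensor_space tens n) A" "csubspace M" "closed M"
    and "\<And>\<xi> \<eta>s. length \<eta>s = n \<Longrightarrow> A (tens \<xi> \<eta>s) \<in> M"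
  shows "A ` tensor_space tens n \<subseteq> M"
  using assms unfolding tensor_space_def
  by (intro bounded_clinear_on_total_image_subset) auto

lemma bounded_clinear_on_tensor_space_eq:
  assumes "bounded_clinear_on (tensor_space tens n) A" "bounded_clinear_on (tensor_space tens n) B"
    and "\<And>\<xi> \<eta>s. length \<eta>s = n \<Longrightarrow> A (tens \<xi> \<eta>s) = B (tens \<xi> \<eta>s)"
    and "x \<in> tensor_space tens n"
  shows "A x = B x"
  using assms unfolding tensor_space_def by (elim bounded_clinear_on_total_eq) auto

text \<open>Justifies the definite description in \<open>tensor_extend\<close>: the bound gives
  existence by extension from elementary tensors, while totality of these and the value 0 elsewhere
  give uniqueness.\<close>

lemma tensor_extend_bounded:
  fixes tens :: "'h::complex_inner \<Rightarrow> 'p::complex_inner list \<Rightarrow> 't::complex_inner"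
    and f :: "'h \<Rightarrow> 'p list \<Rightarrow> 'b::chilbert_space"
  assumes bound: "\<And>J c. finite J \<Longrightarrow> J \<subseteq> {(\<xi>, \<eta>s). length \<eta>s = n} \<Longrightarrow>
    norm (\<Sum>i\<in>J. c i *\<^sub>C (case i of (\<xi>, \<eta>s) \<Rightarrow> f \<xi> \<eta>s)) \<le>
    K * norm (\<Sum>i\<in>J. c i *\<^sub>C (case i of (\<xi>, \<eta>s) \<Rightarrow> tens \<xi> \<eta>s))"
  shows "bounded_clinear_on (tensor_space tens n) (tensor_extend tens n f)"
    and "length \<eta>s = n \<Longrightarrow> tensor_extend tens n f (tens \<xi> \<eta>s) = f \<xi> \<eta>s"
proof -
  let ?P = "\<lambda>A. bounded_clinear_on (tensor_space tens n) A \<and>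
    (\<forall>\<xi> \<eta>s. length \<eta>s = n \<longrightarrow> A (tens \<xi> \<eta>s) = f \<xi> \<eta>s) \<and>
    (\<forall>x. x \<notin> tensor_space tens n \<longrightarrow> A x = 0)"
  obtain A where A: "bounded_clinear_on (tensor_space tens n) A"
    "\<And>i. i \<in> {(\<xi>, \<eta>s). length \<eta>s = n} \<Longrightarrow>
      A (case i of (\<xi>, \<eta>s) \<Rightarrow> tens \<xi> \<eta>s) = (case i of (\<xi>, \<eta>s) \<Rightarrow> f \<xi> \<eta>s)"
    using bounded_clinear_extension[OF bound] unfolding tensor_space_eq by blast
  \<comment> \<open>The extension is arbitrary off the tensor space; cutting it to 0 there meets the
    last clause of the description.\<close>
  define A' where "A' x = (if x \<in> tensor_space tens n then A x else 0)" for x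
  have "bounded_clinear_on (tensor_space tens n) A'"
    using A(1) by (simp add: bounded_clinear_on_def clinear_on_def A'_def
        complex_vector.subspace_add[OF csubspace_tensor_space]
        complex_vector.subspace_scale[OF csubspace_tensor_space])
  then have "?P A'"
    using A(2) by (auto simp: A'_def tens_in_tensor_space)
  moreover have "B = A'" if "?P B" for B
  proof
    fix x
    show "B x = A' x"
      using bounded_clinear_on_tensor_space_eq[of tens n B A' x] that \<open>?P A'\<close>
      by (cases "x \<in> tensor_space tens n") auto
  qed
  ultimately have "?P (tensor_extend tens n f)"
    unfolding tensor_extend_def by (rule theI)
  then show "bounded_clinear_on (tensor_space tens n) (tensor_extend tens n f)"
    and "length \<eta>s = n \<Longrightarrow> tensor_extend tens n f (tens \<xi> \<eta>s) = f \<xi> \<eta>s"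
    by auto
qed

text \<open>Equal Gram matrices yield the required bound with constant 1, and then norm preservation
  on the whole tensor space.\<close>

lemma tensor_extend_isometry:
  fixes tens :: "'h::complex_inner \<Rightarrow> 'p::complex_inner list \<Rightarrow> 't::complex_inner"
    and f :: "'h \<Rightarrow> 'p list \<Rightarrow> 'b::chilbert_space"
  assumes f: "\<And>\<xi> \<eta>s \<xi>' \<eta>s'. length \<eta>s = n \<Longrightarrow> length \<eta>s' = n \<Longrightarrow>
    cinner (f \<xi> \<eta>s) (f \<xi>' \<eta>s') = cinner (tens \<xi> \<eta>s) (tens \<xi>' \<eta>s')"
  shows "isometry_on (tensor_space tens n) (tensor_extend tens n f)"
    and "length \<eta>s = n \<Longrightarrow> tensor_extend tens n f (tens \<xi> \<eta>s) = f \<xi> \<eta>s"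
proof -
  have bound: "norm (\<Sum>i\<in>J. c i *\<^sub>C (case i of (\<xi>, \<eta>s) \<Rightarrow> f \<xi> \<eta>s)) \<le>
    1 * norm (\<Sum>i\<in>J. c i *\<^sub>C (case i of (\<xi>, \<eta>s) \<Rightarrow> tens \<xi> \<eta>s))"
    if "J \<subseteq> {(\<xi>, \<eta>s). length \<eta>s = n}" for J c
  proof -
    have "norm (\<Sum>i\<in>J. c i *\<^sub>C (case i of (\<xi>, \<eta>s) \<Rightarrow> f \<xi> \<eta>s)) =
      norm (\<Sum>i\<in>J. c i *\<^sub>C (case i of (\<xi>, \<eta>s) \<Rightarrow> tens \<xi> \<eta>s))"
      by (rule norm_linear_combination_eq) (use that in \<open>auto intro!: f\<close>)
    then show ?thesis by simp
  qed
  note ext = tensor_extend_bounded[of n f 1 tens, OF bound]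
  show "length \<eta>s = n \<Longrightarrow> tensor_extend tens n f (tens \<xi> \<eta>s) = f \<xi> \<eta>s"
    by (rule ext(2))
  show "isometry_on (tensor_space tens n) (tensor_extend tens n f)"
    using ext(1) unfolding tensor_space_def
    by (rule isometry_on_total) (use ext(2) f in auto)
qed

lemma map2_replicate_id: "length xs = n \<Longrightarrow> map2 (\<lambda>f. f) (replicate n id) xs = xs"
  by (intro nth_equalityI) auto

section \<open>Operators acting on a single tensor factor\<close>

locale hilbert_tensor_product =
  fixes tens :: "'h::chilbert_space \<Rightarrow> 'p::chilbert_space list \<Rightarrow> 't::chilbert_space"
  assumes hilbert_tensor: "hilbert_tensor tens"
begin

lemma tens_clinear_left: "clinear_on UNIV (\<lambda>\<xi>. tens \<xi> \<eta>s)"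
  using hilbert_tensor by (auto simp: hilbert_tensor_def)

lemma cinner_tens:
  "length \<eta>s = length \<eta>s' \<Longrightarrow>
    cinner (tens \<xi> \<eta>s) (tens \<xi>' \<eta>s') = cinner \<xi> \<xi>' * prod_list (map2 cinner \<eta>s \<eta>s')"
  using hilbert_tensor by (auto simp: hilbert_tensor_def)

lemma norm_tens_single: "norm (tens \<xi> [\<eta>]) = norm \<xi> * norm \<eta>"
proof -
  have "complex_of_real ((norm (tens \<xi> [\<eta>]))\<^sup>2) = complex_of_real ((norm \<xi> * norm \<eta>)\<^sup>2)"
    unfolding cinner_self[symmetric] of_real_mult power_mult_distrib by (simp add: cinner_tens)
  then have "(norm (tens \<xi> [\<eta>]))\<^sup>2 = (norm \<xi> * norm \<eta>)\<^sup>2"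
    unfolding of_real_eq_iff .
  then show ?thesis
    by (rule power2_eq_imp_eq) auto
qed

lemma bounded_clinear_on_tens_single: "bounded_clinear_on UNIV (\<lambda>\<xi>. tens \<xi> [\<eta>])"
  using tens_clinear_left
  by (auto simp: bounded_clinear_on_def norm_tens_single mult.commute intro!: exI[of _ "norm \<eta>"])

text \<open>\<open>\<xi>\<^sub>0 \<otimes> \<eta>\<^sub>1 \<otimes> \<dots> \<otimes> \<eta>\<^sub>n\<close> with a unit vector \<open>\<xi>\<^sub>0\<close> stands for \<open>\<eta>\<^sub>1 \<otimes> \<dots> \<otimes> \<eta>\<^sub>n\<close>; it exists unless \<open>\<H> = 0\<close>.\<close>

lemma tensor_op_state:
  assumes X: "bounded_clinear_on UNIV X"
  shows "bounded_clinear_on (tensor_space tens n) (tensor_op tens X (replicate n id))"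
    and "length \<eta>s = n \<Longrightarrow> tensor_op tens X (replicate n id) (tens \<xi> \<eta>s) = tens (X \<xi>) \<eta>s"
proof -
  obtain K where K: "0 \<le> K" "\<And>x. norm (X x) \<le> K * norm x"
    using bounded_clinear_on_bound[OF X] by (metis UNIV_I)
  let ?f = "\<lambda>\<xi> \<eta>s. tens (X \<xi>) (map2 (\<lambda>Y. Y) (replicate n id) \<eta>s)"
  have bound: "norm (\<Sum>i\<in>J. c i *\<^sub>C (case i of (\<xi>, \<eta>s) \<Rightarrow> ?f \<xi> \<eta>s)) \<le>
      K * norm (\<Sum>i\<in>J. c i *\<^sub>C (case i of (\<xi>, \<eta>s) \<Rightarrow> tens \<xi> \<eta>s))"
    if J: "finite J" "J \<subseteq> {(\<xi>, \<eta>s). length \<eta>s = n}" for J c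
  proof (cases "\<forall>\<xi>::'h. \<xi> = 0")
    \<comment> \<open>There is no unit vector in the zero space, but then linearity in the first
      factor makes every tensor vanish.\<close>
    case True
    have "tens 0 \<eta>s = 0" for \<eta>s
      using clinear_on_zero[OF tens_clinear_left complex_vector.subspace_UNIV] .
    then have "?f \<xi> \<eta>s = 0" for \<xi> \<eta>s
      using True by metis
    then show ?thesis
      using K(1) by (simp add: case_prod_beta)
  next
    case False
    then obtain \<xi>\<^sub>1 :: 'h where \<xi>\<^sub>1: "\<xi>\<^sub>1 \<noteq> 0" by blast
    define \<xi>\<^sub>0 where "\<xi>\<^sub>0 = complex_of_real (inverse (norm \<xi>\<^sub>1)) *\<^sub>C \<xi>\<^sub>1"
    have "norm \<xi>\<^sub>0 = 1"
      using \<xi>\<^sub>1 by (simp add: \<xi>\<^sub>0_def norm_scaleC norm_inverse)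
    then have "cinner \<xi>\<^sub>0 \<xi>\<^sub>0 = 1"
      by (simp add: cinner_self)
    \<comment> \<open>The kernel estimate is applied with the vector in the state space as first
      factor; the unit vector \<open>\<xi>\<^sub>0\<close> contributes 1, so \<open>b\<close> has
      exactly the inner products of the remaining factors.\<close>
    then show ?thesis
      using J K by (intro norm_linear_combination_kernel_le[where a = fst and X = X
            and b = "\<lambda>i. tens \<xi>\<^sub>0 (snd i)"] bounded_clinear_onD[OF X])
        (auto simp: cinner_tens map2_replicate_id subset_iff)
  qed
  note ext = tensor_extend_bounded[of n ?f K tens, OF bound]
  show "bounded_clinear_on (tensor_space tens n) (tensor_op tens X (replicate n id))"
    using ext(1) by (simp add: tensor_op_def)
  show "tensor_op tens X (replicate n id) (tens \<xi> \<eta>s) = tens (X \<xi>) \<eta>s" if "length \<eta>s = n"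
    using ext(2)[OF _ _ that] that by (simp add: tensor_op_def map2_replicate_id)
qed

text \<open>The same kernel estimate with the roles exchanged: the last factor, on which
  \<open>Y\<close> acts, is split off, and \<open>b\<close> collects the state vector together with
  the other factors.\<close>

lemma tensor_op_output:
  assumes Y: "bounded_clinear_on UNIV Y"
  shows "bounded_clinear_on (tensor_space tens (Suc n)) (tensor_op tens id (replicate n id @ [Y]))"
    and "length \<eta>s = n \<Longrightarrow>
      tensor_op tens id (replicate n id @ [Y]) (tens \<xi> (\<eta>s @ [\<eta>])) = tens \<xi> (\<eta>s @ [Y \<eta>])"
proof -
  obtain K where K: "0 \<le> K" "\<And>x. norm (Y x) \<le> K * norm x"
    using bounded_clinear_on_bound[OF Y] by (metis UNIV_I)
  let ?g = "\<lambda>\<eta>s. map2 (\<lambda>Y. Y) (replicate n id @ [Y]) \<eta>s"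
  have map2_snoc: "?g (\<zeta>s @ [\<zeta>]) = \<zeta>s @ [Y \<zeta>]" if "length \<zeta>s = n" for \<zeta>s \<zeta>
    using that map2_replicate_id[OF that] by simp
  have bound: "norm (\<Sum>i\<in>J. c i *\<^sub>C (case i of (\<xi>, \<eta>s) \<Rightarrow> tens (id \<xi>) (?g \<eta>s))) \<le>
      K * norm (\<Sum>i\<in>J. c i *\<^sub>C (case i of (\<xi>, \<eta>s) \<Rightarrow> tens \<xi> \<eta>s))"
    if J: "finite J" "J \<subseteq> {(\<xi>, \<eta>s). length \<eta>s = Suc n}" for J c
  proof (rule norm_linear_combination_kernel_le[where a = "\<lambda>i. last (snd i)" and X = Y
        and b = "\<lambda>i. tens (fst i) (butlast (snd i))"])
    fix i j assume "i \<in> J" "j \<in> J"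
    then have "length (snd i) = Suc n" "length (snd j) = Suc n"
      using J(2) by auto
    then obtain \<zeta>s \<zeta> \<zeta>s' \<zeta>' where "snd i = \<zeta>s @ [\<zeta>]" "length \<zeta>s = n"
      "snd j = \<zeta>s' @ [\<zeta>']" "length \<zeta>s' = n"
      unfolding length_Suc_conv_rev by blast
    then have "i = (fst i, \<zeta>s @ [\<zeta>])" "length \<zeta>s = n" "j = (fst j, \<zeta>s' @ [\<zeta>'])" "length \<zeta>s' = n"
      by (metis prod.collapse)+
    then obtain \<xi> \<xi>' where "i = (\<xi>, \<zeta>s @ [\<zeta>])" "length \<zeta>s = n"
      "j = (\<xi>', \<zeta>s' @ [\<zeta>'])" "length \<zeta>s' = n"
      by blast
    then show "cinner (case i of (\<xi>, \<eta>s) \<Rightarrow> tens \<xi> \<eta>s) (case j of (\<xi>, \<eta>s) \<Rightarrow> tens \<xi> \<eta>s) =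
        cinner (last (snd i)) (last (snd j)) *
        cinner (tens (fst i) (butlast (snd i))) (tens (fst j) (butlast (snd j)))"
      and "cinner (case i of (\<xi>, \<eta>s) \<Rightarrow> tens (id \<xi>) (?g \<eta>s)) (case j of (\<xi>, \<eta>s) \<Rightarrow> tens (id \<xi>) (?g \<eta>s)) =
        cinner (Y (last (snd i))) (Y (last (snd j))) *
        cinner (tens (fst i) (butlast (snd i))) (tens (fst j) (butlast (snd j)))"
      using map2_snoc by (simp_all add: cinner_tens mult_ac)
  qed (use J K Y bounded_clinear_onD in auto)
  note ext = tensor_extend_bounded[of "Suc n" "\<lambda>\<xi> \<eta>s. tens (id \<xi>) (?g \<eta>s)" K tens, OF bound]
  show "bounded_clinear_on (tensor_space tens (Suc n)) (tensor_op tens id (replicate n id @ [Y]))"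
    using ext(1) by (simp add: tensor_op_def)
  show "tensor_op tens id (replicate n id @ [Y]) (tens \<xi> (\<eta>s @ [\<eta>])) = tens \<xi> (\<eta>s @ [Y \<eta>])"
    if "length \<eta>s = n"
    using ext(2)[of "\<eta>s @ [\<eta>]" \<xi>] that map2_snoc[OF that] by (simp add: tensor_op_def)
qed

end


section \<open>Iterated row isometries\<close>

text \<open>A direct recursion for the values of the iterated row isometry on elementary tensors,
  which avoids passing through \<open>tensor_extend\<close>. The head of the list is fed to the
  outermost \<open>V\<close>, matching the order of letters in \<open>row_word\<close>.\<close>

primrec row_tens ::
  "('h::complex_inner \<Rightarrow> 'p::complex_inner list \<Rightarrow> 't::complex_inner) \<Rightarrow> ('t \<Rightarrow> 'h) \<Rightarrow>
   'h \<Rightarrow> 'p list \<Rightarrow> 'h" where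
  "row_tens tens V \<xi> [] = \<xi>"
| "row_tens tens V \<xi> (\<eta> # \<eta>s) = V (tens (row_tens tens V \<xi> \<eta>s) [\<eta>])"

text \<open>Allows trailing factors to be absorbed into the state vector, so that an operation on
  the first factors can be evaluated on longer tensors.\<close>

lemma row_tens_append:
  "row_tens tens V \<xi> (\<eta>s @ \<zeta>s) = row_tens tens V (row_tens tens V \<xi> \<zeta>s) \<eta>s"
  by (induction \<eta>s) auto

lemma row_word_eq_row_tens: "row_word tens \<epsilon> V \<alpha> \<xi> = row_tens tens V \<xi> (map \<epsilon> \<alpha>)"
  by (induction \<alpha>) (auto simp: row_entry_def)

text \<open>Every partial sum of the series representing \<open>\<xi>\<close> lies in the range of
  \<open>V\<close>, and this range is closed as the image of a complete space under an
  isometry.\<close>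

lemma row_unitary_surj:
  fixes tens :: "'h::chilbert_space \<Rightarrow> 'p::chilbert_space list \<Rightarrow> 't::chilbert_space"
  assumes "row_unitary tens d \<epsilon> V"
  shows "V ` tensor_space tens 1 = UNIV"
proof -
  have V: "isometry_on (tensor_space tens 1) V"
    and sums: "\<And>\<xi>. ((\<lambda>k. V (tens (adjoint_on UNIV (row_entry tens \<epsilon> V k) \<xi>) [\<epsilon> k])) has_sum \<xi>)
      (letters d)"
    using assms by (auto simp: row_unitary_def row_isometry_def row_entry_def)
  let ?M = "V ` tensor_space tens 1"
  have sub: "csubspace ?M"
    using V csubspace_clinear_image csubspace_tensor_space by (auto simp: isometry_on_def)
  have "\<xi> \<in> ?M" for \<xi>
  proof (rule Lim_in_closed_set)
    show "closed ?M"
      using closed_isometry_image[OF V csubspace_tensor_space closed_tensor_space] .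
    show "((\<lambda>F. \<Sum>k\<in>F. V (tens (adjoint_on UNIV (row_entry tens \<epsilon> V k) \<xi>) [\<epsilon> k])) \<longlongrightarrow> \<xi>)
        (finite_subsets_at_top (letters d))"
      using sums by (simp add: has_sum_def)
    show "\<forall>\<^sub>F F in finite_subsets_at_top (letters d).
        (\<Sum>k\<in>F. V (tens (adjoint_on UNIV (row_entry tens \<epsilon> V k) \<xi>) [\<epsilon> k])) \<in> ?M"
      by (intro always_eventually allI complex_vector.subspace_sum[OF sub] imageI
          tens_in_tensor_space) simp
  qed simp
  then show ?thesis by blast
qed

locale row_unitary_tensor = hilbert_tensor_product tens
  for tens :: "'h::chilbert_space \<Rightarrow> 'p::chilbert_space list \<Rightarrow> 't::chilbert_space" +
  fixes V :: "'t \<Rightarrow> 'h"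
  assumes V_isometry: "isometry_on (tensor_space tens 1) V"
    and V_surj: "V ` tensor_space tens 1 = UNIV"
begin

abbreviation "W \<equiv> row_tens tens V"

lemma bounded_clinear_on_V_tens: "bounded_clinear_on UNIV (\<lambda>\<xi>. V (tens \<xi> [\<eta>]))"
  using bounded_clinear_on_comp[OF bounded_clinear_on_tens_single
      isometry_on_bounded[OF V_isometry]]
  by (simp add: comp_def image_subset_iff tens_in_tensor_space)

text \<open>Each application of \<open>V\<close> preserves inner products and splits off the factor
  belonging to the head of the list.\<close>

lemma cinner_row_tens:
  assumes "length \<eta>s = length \<eta>s'"
  shows "cinner (W \<xi> \<eta>s) (W \<xi>' \<eta>s') = cinner (tens \<xi> \<eta>s) (tens \<xi>' \<eta>s')"
  using assms
  by (induction \<eta>s \<eta>s' rule: list_induct2)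
    (simp_all add: isometry_on_cinner[OF V_isometry csubspace_tensor_space] tens_in_tensor_space
      cinner_tens mult_ac)

text \<open>By the induction hypothesis the values prescribed for the next power are those of
  \<open>W\<close>, whose Gram matrix is that of the elementary tensors, so the extension exists and
  is isometric.\<close>

lemma row_power_isometry_row_tens:
  "isometry_on (tensor_space tens n) (row_power tens V n) \<and>
    (\<forall>\<xi> \<eta>s. length \<eta>s = n \<longrightarrow> row_power tens V n (tens \<xi> \<eta>s) = W \<xi> \<eta>s)"
proof (induction n)
  case 0
  show ?case
    using tensor_extend_isometry[of 0 "\<lambda>\<xi> _. \<xi>" tens] by (simp add: cinner_tens)
next
  case (Suc n)
  show ?case
  \<comment> \<open>The first power is \<open>V\<close> itself and not a
    \<open>tensor_extend\<close>, hence the separate case.\<close>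
  proof (cases n)
    case 0
    then show ?thesis
      using V_isometry by (auto simp: length_Suc_conv)
  next
    case (Suc k)
    let ?f = "\<lambda>\<xi> \<eta>s. V (tens (row_power tens V n (tens \<xi> (tl \<eta>s))) [hd \<eta>s])"
    have f: "?f \<xi> \<eta>s = W \<xi> \<eta>s" if "length \<eta>s = Suc n" for \<xi> \<eta>s
      using that Suc.IH by (cases \<eta>s) auto
    have cinner_f: "cinner (?f \<xi> \<eta>s) (?f \<xi>' \<eta>s') = cinner (tens \<xi> \<eta>s) (tens \<xi>' \<eta>s')"
      if "length \<eta>s = Suc n" "length \<eta>s' = Suc n" for \<xi> \<eta>s \<xi>' \<eta>s'
      using that by (simp only: f cinner_row_tens)
    have "row_power tens V (Suc n) = tensor_extend tens (Suc n) ?f"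
      using Suc by simp
    moreover have "isometry_on (tensor_space tens (Suc n)) (tensor_extend tens (Suc n) ?f)"
      by (rule tensor_extend_isometry(1)) (rule cinner_f)
    moreover have "tensor_extend tens (Suc n) ?f (tens \<xi> \<eta>s) = W \<xi> \<eta>s" if "length \<eta>s = Suc n" for \<xi> \<eta>s
    proof -
      have "tensor_extend tens (Suc n) ?f (tens \<xi> \<eta>s) = ?f \<xi> \<eta>s"
        using that by (rule tensor_extend_isometry(2)[rotated]) (rule cinner_f)
      also have "\<dots> = W \<xi> \<eta>s"
        using that by (rule f)
      finally show ?thesis .
    qed
    ultimately show ?thesis
      by (simp only:) blast
  qed
qed

lemmas row_power_isometry = row_power_isometry_row_tens[THEN conjunct1]

lemma row_power_tens: "length \<eta>s = n \<Longrightarrow> row_power tens V n (tens \<xi> \<eta>s) = W \<xi> \<eta>s"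
  using row_power_isometry_row_tens by blast

text \<open>By induction, the bounded maps
  \<open>\<zeta> \<mapsto> V (tens \<zeta> [\<eta>])\<close> carry a total set for \<open>n\<close>
  into the closed span for \<open>Suc n\<close>. This closed span therefore contains the range of
  \<open>V\<close>, which is everything.\<close>

lemma row_tens_total: "closure (cspan {W \<xi> \<eta>s |\<xi> \<eta>s. length \<eta>s = n}) = UNIV"
proof (induction n)
  case 0
  show ?case
    using closure_cspan_base by auto
next
  case (Suc n)
  let ?M = "closure (cspan {W \<xi> \<eta>s |\<xi> \<eta>s. length \<eta>s = Suc n})"
  have "V (tens \<zeta> [\<eta>]) \<in> ?M" for \<zeta> \<eta>
  proof -
    have "(\<lambda>\<zeta>. V (tens \<zeta> [\<eta>])) ` closure (cspan {W \<xi> \<eta>s |\<xi> \<eta>s. length \<eta>s = n}) \<subseteq> ?M"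
    proof (rule bounded_clinear_on_total_image_subset)
      show "(\<lambda>\<zeta>. V (tens \<zeta> [\<eta>])) ` {W \<xi> \<eta>s |\<xi> \<eta>s. length \<eta>s = n} \<subseteq> ?M"
      proof clarify
        fix \<xi> and \<eta>s :: "'p list" assume "n = length \<eta>s"
        then show "V (tens (W \<xi> \<eta>s) [\<eta>]) \<in> closure (cspan {W \<xi> \<eta>s' |\<xi> \<eta>s'. length \<eta>s' = Suc (length \<eta>s)})"
          by (intro closure_cspan_base CollectI exI[of _ \<xi>] exI[of _ "\<eta> # \<eta>s"]) simp
      qed
    qed (simp_all add: Suc bounded_clinear_on_V_tens csubspace_closure_cspan)
    then show ?thesis
      unfolding Suc by blast
  qed
  then have "V ` tensor_space tens 1 \<subseteq> ?M"
    by (intro bounded_clinear_on_tensor_space_image_subset isometry_on_bounded[OF V_isometry])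
      (auto simp: csubspace_closure_cspan length_Suc_conv)
  then show ?case
    using V_surj by blast
qed

text \<open>The length \<open>n\<close> is free: it is chosen large enough that the list contains
  all places at which the compared operators act.\<close>

lemma row_tens_eqI:
  assumes A: "bounded_clinear_on UNIV A" and B: "bounded_clinear_on UNIV B"
    and eq: "\<And>\<xi> \<eta>s. length \<eta>s = n \<Longrightarrow> A (W \<xi> \<eta>s) = B (W \<xi> \<eta>s)"
  shows "A = B"
proof
  fix x
  show "A x = B x"
    by (rule bounded_clinear_on_total_eq[of "{W \<xi> \<eta>s |\<xi> \<eta>s. length \<eta>s = n}"])
      (use A B eq in \<open>auto simp: row_tens_total\<close>)
qed

lemma row_power_surj: "row_power tens V n ` tensor_space tens n = UNIV"
proof -
  let ?M = "row_power tens V n ` tensor_space tens n"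
  have "csubspace ?M"
    by (intro csubspace_clinear_image csubspace_tensor_space bounded_clinear_onD
        isometry_on_bounded row_power_isometry)
  moreover have "closed ?M"
    by (rule closed_isometry_image[OF row_power_isometry csubspace_tensor_space closed_tensor_space])
  moreover have "{W \<xi> \<eta>s |\<xi> \<eta>s. length \<eta>s = n} \<subseteq> ?M"
    by (auto simp: tens_in_tensor_space simp flip: row_power_tens)
  ultimately have "closure (cspan {W \<xi> \<eta>s |\<xi> \<eta>s. length \<eta>s = n}) \<subseteq> ?M"
    by (intro closure_cspan_minimal)
  then show ?thesis
    unfolding row_tens_total by blast
qed

text \<open>The adjoint of the iterated isometry is its inverse and sends
  \<open>W \<xi> \<eta>s\<close> back to the elementary tensor, where the tensor operator can be
  evaluated.\<close>

lemma row_conj_bounded: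
  assumes op: "bounded_clinear_on (tensor_space tens (length Ys)) (tensor_op tens X Ys)"
    and range: "\<And>\<xi> \<eta>s. length \<eta>s = length Ys \<Longrightarrow>
      tensor_op tens X Ys (tens \<xi> \<eta>s) \<in> tensor_space tens (length Ys)"
  shows "bounded_clinear_on UNIV (row_conj tens V X Ys)"
    and "length \<eta>s = length Ys \<Longrightarrow> row_conj tens V X Ys (W \<xi> \<eta>s) =
      row_power tens V (length Ys) (tensor_op tens X Ys (tens \<xi> \<eta>s))"
proof -
  let ?n = "length Ys"
  note adj = adjoint_on_surj_isometry[OF row_power_isometry csubspace_tensor_space row_power_surj]
  \<comment> \<open>Invariance, known on elementary tensors, extends to the whole tensor space
    because that space is closed.\<close>
  have "tensor_op tens X Ys ` tensor_space tens ?n \<subseteq> tensor_space tens ?n"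
    using op csubspace_tensor_space closed_tensor_space range
    by (rule bounded_clinear_on_tensor_space_image_subset)
  then show "bounded_clinear_on UNIV (row_conj tens V X Ys)"
    unfolding row_conj_def comp_assoc using adj[of ?n]
    by (intro bounded_clinear_on_comp[where T = "tensor_space tens ?n"] op
        isometry_on_bounded[OF adj(1)] isometry_on_bounded[OF row_power_isometry])
      (auto simp: image_subset_iff)
  show "length \<eta>s = ?n \<Longrightarrow> row_conj tens V X Ys (W \<xi> \<eta>s) =
      row_power tens V ?n (tensor_op tens X Ys (tens \<xi> \<eta>s))"
    using adjoint_on_isometry[OF row_power_isometry csubspace_tensor_space tens_in_tensor_space]
    by (simp add: row_conj_def flip: row_power_tens)
qed

section \<open>Action of the observables and their commutation\<close>

lemma state_observable:
  assumes X: "bounded_clinear_on UNIV X"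
  shows "bounded_clinear_on UNIV (state_observable tens V X n)"
    and "length \<eta>s = n \<Longrightarrow> state_observable tens V X n (W \<xi> \<eta>s) = W (X \<xi>) \<eta>s"
  using row_conj_bounded[of "replicate n id" X] tensor_op_state[OF X]
  by (simp_all add: state_observable_def tens_in_tensor_space row_power_tens)

text \<open>Conjugation gives the formula directly for lists of length \<open>m\<close>. Longer
  lists reduce to this case by absorbing everything after the first \<open>m\<close> factors into
  the state vector. Place \<open>m\<close> has list index \<open>m - 1\<close>.\<close>

lemma output_observable:
  assumes Y: "bounded_clinear_on UNIV Y" and "1 \<le> m"
  shows "bounded_clinear_on UNIV (output_observable tens V Y m)"
    and "m \<le> length \<eta>s \<Longrightarrow>
      output_observable tens V Y m (W \<xi> \<eta>s) = W \<xi> (\<eta>s[m - 1 := Y (\<eta>s ! (m - 1))])"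
proof -
  obtain n where m: "m = Suc n"
    using \<open>1 \<le> m\<close> by (cases m) auto
  have op: "tensor_op tens id (replicate n id @ [Y]) (tens \<xi> (\<eta>s @ [\<eta>])) = tens \<xi> (\<eta>s @ [Y \<eta>])"
    if "length \<eta>s = n" for \<xi> \<eta>s \<eta>
    using tensor_op_output(2)[OF Y that] .
  have range: "tensor_op tens id (replicate n id @ [Y]) (tens \<xi> \<eta>s) \<in> tensor_space tens (Suc n)"
    if "length \<eta>s = Suc n" for \<xi> \<eta>s
    using that op by (auto simp: length_Suc_conv_rev tens_in_tensor_space)
  note conj = row_conj_bounded[of "replicate n id @ [Y]" id]
  show "bounded_clinear_on UNIV (output_observable tens V Y m)"
    using conj(1) tensor_op_output(1)[OF Y] range by (simp add: output_observable_def m)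
  have snoc_eq: "output_observable tens V Y m (W \<xi> (\<zeta>s @ [\<zeta>])) = W \<xi> (\<zeta>s @ [Y \<zeta>])"
    if "length \<zeta>s = n" for \<xi> \<zeta>s \<zeta>
    using conj(2)[of "\<zeta>s @ [\<zeta>]" \<xi>] tensor_op_output(1)[OF Y] range that op[OF that]
    by (simp add: output_observable_def m row_power_tens)
  show "output_observable tens V Y m (W \<xi> \<eta>s) = W \<xi> (\<eta>s[m - 1 := Y (\<eta>s ! (m - 1))])"
    if "m \<le> length \<eta>s"
  proof -
    \<comment> \<open>The list is cut into the \<open>m - 1\<close> untouched factors, the factor
      changed by \<open>Y\<close>, and the tail to be absorbed.\<close>
    define \<zeta>s where "\<zeta>s = take n \<eta>s"
    have \<zeta>s: "length \<zeta>s = n" and \<eta>s: "\<eta>s = (\<zeta>s @ [\<eta>s ! n]) @ drop m \<eta>s"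
      using that by (simp_all add: \<zeta>s_def m id_take_nth_drop)
    have upd: "\<eta>s[n := y] = (\<zeta>s @ [y]) @ drop m \<eta>s" for y
      using that by (simp add: \<zeta>s_def m upd_conv_take_nth_drop)
    have "output_observable tens V Y m (W \<xi> \<eta>s) =
        output_observable tens V Y m (W (W \<xi> (drop m \<eta>s)) (\<zeta>s @ [\<eta>s ! n]))"
      by (subst \<eta>s) (simp only: row_tens_append)
    also have "\<dots> = W \<xi> (\<eta>s[n := Y (\<eta>s ! n)])"
      unfolding snoc_eq[OF \<zeta>s] upd by (simp only: row_tens_append)
    finally show ?thesis
      by (simp add: m)
  qed
qed

lemma output_observables_commute:
  assumes Y: "bounded_clinear_on UNIV Y" and m: "1 \<le> m" "1 \<le> m'"
  shows "output_observable tens V Y m \<circ> output_observable tens V Y m' =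
    output_observable tens V Y m' \<circ> output_observable tens V Y m"
proof (cases "m = m'")
  case False
  note Ym = output_observable[OF Y m(1)] and Ym' = output_observable[OF Y m(2)]
  from False m have "m - 1 \<noteq> m' - 1" by simp
  show ?thesis
  \<comment> \<open>With this length both places exist, and updates at distinct places can be
    interchanged.\<close>
  proof (rule row_tens_eqI[where n = "max m m'"])
    fix \<xi> and \<eta>s :: "'p list" assume "length \<eta>s = max m m'"
    then show "(output_observable tens V Y m \<circ> output_observable tens V Y m') (W \<xi> \<eta>s) =
        (output_observable tens V Y m' \<circ> output_observable tens V Y m) (W \<xi> \<eta>s)"
      using \<open>m - 1 \<noteq> m' - 1\<close> by (simp add: Ym(2) Ym'(2) list_update_swap)
  qed (rule bounded_clinear_on_comp[where T = UNIV], simp_all add: Ym(1) Ym'(1))+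
qed simp

text \<open>On product vectors with \<open>n\<close> factors one operator changes the state vector
  and the other a list entry; \<open>m \<le> n\<close> guarantees that this entry is
  present.\<close>

lemma output_state_observable_commute:
  assumes X: "bounded_clinear_on UNIV X" and Y: "bounded_clinear_on UNIV Y"
    and m: "1 \<le> m" "m \<le> n"
  shows "output_observable tens V Y m \<circ> state_observable tens V X n =
    state_observable tens V X n \<circ> output_observable tens V Y m"
proof -
  note Ym = output_observable[OF Y m(1)] and Xn = state_observable[OF X]
  show ?thesis
  proof (rule row_tens_eqI[where n = n])
    fix \<xi> and \<eta>s :: "'p list" assume "length \<eta>s = n"
    then show "(output_observable tens V Y m \<circ> state_observable tens V X n) (W \<xi> \<eta>s) =
        (state_observable tens V X n \<circ> output_observable tens V Y m) (W \<xi> \<eta>s)"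
      using m by (simp add: Ym(2) Xn(2))
  qed (rule bounded_clinear_on_comp[where T = UNIV], simp_all add: Ym(1) Xn(1))+
qed

end

section \<open>Measurement outcomes\<close>

lemma projection_onto_unit_vector:
  assumes "cinner e e = 1"
  shows "projection_onto (cspan {e}) x = cinner e x *\<^sub>C e"
  unfolding projection_onto_def
proof (rule the_equality)
  show "cinner e x *\<^sub>C e \<in> cspan {e} \<and> (\<forall>z\<in>cspan {e}. cinner z (x - cinner e x *\<^sub>C e) = 0)"
    using assms by (auto simp: complex_vector.span_singleton cinner_scaleC_left cinner_diff_right
        cinner_scaleC_right)
next
  fix y assume y: "y \<in> cspan {e} \<and> (\<forall>z\<in>cspan {e}. cinner z (x - y) = 0)"
  then obtain c where c: "y = c *\<^sub>C e"
    by (auto simp: complex_vector.span_singleton)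
  have "cinner e (x - y) = 0"
    using y by (auto intro: complex_vector.span_base)
  then show "y = cinner e x *\<^sub>C e"
    using assms by (simp add: c cinner_diff_right cinner_scaleC_right)
qed

text \<open>Bessel's inequality for one unit vector, read off from the squared norm of the
  remainder. It makes the projection admissible as an output observable even where the measured
  operator is unbounded.\<close>

lemma bounded_clinear_on_projection_onto_unit_vector:
  assumes "cinner e e = 1"
  shows "bounded_clinear_on UNIV (projection_onto (cspan {e}))"
proof -
  have "cmod (cinner e x) \<le> norm x" for x
  proof -
    have "cinner (x - cinner e x *\<^sub>C e) (x - cinner e x *\<^sub>C e) =
        cinner x x - cinner e x * cnj (cinner e x)"
      using assms cinner_commute[of x e]
      by (simp add: cinner_diff_right cinner_diff_left cinner_scaleC_right cinner_scaleC_left)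
    then have "(norm (x - cinner e x *\<^sub>C e))\<^sup>2 = (norm x)\<^sup>2 - (cmod (cinner e x))\<^sup>2"
      unfolding cinner_self complex_norm_square[symmetric] of_real_diff[symmetric] of_real_eq_iff .
    then have "(cmod (cinner e x))\<^sup>2 \<le> (norm x)\<^sup>2"
      by (smt (verit) zero_le_power2)
    then show ?thesis
      by (rule power2_le_imp_le) simp
  qed
  moreover have "norm e = 1"
    using assms norm_ge_zero[of e] by (auto simp: cinner_self power2_eq_1_iff simp flip: of_real_power)
  ultimately show ?thesis
    by (auto simp: bounded_clinear_on_def clinear_on_def projection_onto_unit_vector[OF assms]
        cinner_add_right scaleC_add_left cinner_scaleC_right scaleC_scaleC norm_scaleC
        intro!: exI[of _ 1])
qed

text \<open>The observable replaces the \<open>m\<close>-th factor by its own projection, hence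
  fixes \<open>\<eta>\<close>, and the probability becomes the squared norm of
  \<open>\<eta>\<close>.\<close>

lemma (in row_unitary_tensor) outcome_probability_row_word:
  assumes unit: "\<And>j. j \<in> set \<alpha> \<Longrightarrow> cinner (\<epsilon> j) (\<epsilon> j) = 1"
    and m: "1 \<le> m" "m \<le> length \<alpha>"
    and \<eta>: "\<eta> \<in> range (row_word tens \<epsilon> V \<alpha>)" "norm \<eta> = 1"
  shows "outcome_probability tens \<epsilon> V m \<eta> (\<alpha> ! (m - 1)) = 1"
proof -
  let ?e = "\<epsilon> (\<alpha> ! (m - 1))"
  obtain \<xi> where \<xi>: "\<eta> = W \<xi> (map \<epsilon> \<alpha>)"
    using \<eta>(1) by (auto simp: row_word_eq_row_tens)
  have e: "cinner ?e ?e = 1"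
    using m by (intro unit) simp
  have "output_observable tens V (projection_onto (cspan {?e})) m \<eta> =
      W \<xi> ((map \<epsilon> \<alpha>)[m - 1 := projection_onto (cspan {?e}) ?e])"
    using output_observable(2)[OF bounded_clinear_on_projection_onto_unit_vector[OF e] m(1),
        of "map \<epsilon> \<alpha>" \<xi>] m by (simp add: \<xi>)
  also have "projection_onto (cspan {?e}) ?e = ?e"
    by (simp only: projection_onto_unit_vector[OF e] e complex_vector.scale_one)
  also have "(map \<epsilon> \<alpha>)[m - 1 := ?e] = map \<epsilon> \<alpha>"
    using m by (simp add: list_update_same_conv)
  also note \<xi>[symmetric]
  finally show ?thesis
    by (simp add: outcome_probability_def cinner_self \<eta>(2))
qed

text \<open>In the second half \<open>Y\<close> lives on a subspace \<open>D\<close> containing the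
  basis, because for infinite \<open>d\<close> an operator with eigenvalues \<open>j\<close> is
  unbounded; the probability is expressed by its eigenprojections.\<close>

theorem proposition2p6:
  fixes tens :: "'h::chilbert_space \<Rightarrow> 'p::chilbert_space list \<Rightarrow> 't::chilbert_space"
    and d :: enat
    and \<epsilon> :: "nat \<Rightarrow> 'p"
    and V :: "'t \<Rightarrow> 'h"
    and \<hh> :: "'h set"
  assumes "separable_set (UNIV :: 'h set)" and "separable_set (UNIV :: 'p set)"
    and "hilbert_tensor tens"
    and "1 \<le> d" and "orthonormal_basis_on (letters d) \<epsilon>"
    and "unital_process tens d \<epsilon> V \<hh>"
  shows
    "(\<forall>X Y. bounded_clinear_on UNIV X \<and> bounded_clinear_on UNIV Y \<longrightarrow>
        (\<forall>m m'. 1 \<le> m \<and> 1 \<le> m' \<longrightarrow>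
           output_observable tens V Y m \<circ> output_observable tens V Y m' =
           output_observable tens V Y m' \<circ> output_observable tens V Y m) \<and>
        (\<forall>m n. 1 \<le> m \<and> m \<le> n \<longrightarrow>
           output_observable tens V Y m \<circ> state_observable tens V X n =
           state_observable tens V X n \<circ> output_observable tens V Y m)) \<and>
     (\<forall>D Y. csubspace D \<and> clinear_on D Y \<and>
        (\<forall>j\<in>letters d. \<epsilon> j \<in> D \<and> Y (\<epsilon> j) = of_nat j *\<^sub>C \<epsilon> j) \<longrightarrow>
        (\<forall>\<alpha> m k \<eta>. set \<alpha> \<subseteq> letters d \<and> 1 \<le> m \<and> m \<le> length \<alpha> \<and> \<alpha> ! (m - 1) = k \<and>
           \<eta> \<in> range (row_word tens \<epsilon> V \<alpha>) \<and> norm \<eta> = 1 \<longrightarrow>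
           outcome_probability tens \<epsilon> V m \<eta> k = 1))"
proof -
  have "row_unitary tens d \<epsilon> V"
    using assms(6) by (simp add: unital_process_def)
  \<comment> \<open>Unitality enters here, as surjectivity of \<open>V\<close>.\<close>
  then interpret row_unitary_tensor tens V
    using assms(3) by unfold_locales
      (simp_all only: row_unitary_surj, simp add: row_unitary_def row_isometry_def)
  have unit: "cinner (\<epsilon> j) (\<epsilon> j) = 1" if "j \<in> letters d" for j
    using assms(5) that by (simp add: orthonormal_basis_on_def)
  show ?thesis
    using output_observables_commute output_state_observable_commute
      outcome_probability_row_word[of _ \<epsilon>] unit
    by (auto simp: subset_iff)
qed

end
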